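(* Let $K$ be a field of any characteristic, let $a,b,c,d\in K$ be arbitrary, and let \[ F=K\langle x,y\mid x^2+ax+b=0,\ y^2+cy+d=0\rangle . \] (i) The centre $C(F)$ of $F$ is isomorphic, as a $K$-algebra, to the polynomial algebra over $K$ in one variable, and $F$ is a free $C(F)$-module of rank $4$ generated by $1,x,y,xy$. (ii) Every nonzero two-sided ideal of $F$ is of finite codimension in $F$ (as a $K$-vector subspace).
   Context: All algebras are associative and unital. $K\langle x,y\mid x^2+ax+b=0,\ y^2+cy+d=0\rangle$ denotes the quotient of the free unital associative $K$-algebra on $x,y$ by the two-sided ideal generated by $x^2+ax+b$ and $y^2+cy+d$. The images of $x,y$ in $F$ are again denoted by $x,y$. *)

theory Defs
  imports
    "HOL-Algebra.QuotRing"
    "HOL-Algebra.UnivPoly"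
    "Jordan_Normal_Form.Missing_VectorSpace"
begin

section \<open>Free associative algebras\<close>

text \<open>
  The free unital associative algebra over \<open>K\<close> on the alphabet \<open>'v\<close>: an element is the function
  that sends a word to its coefficient, only finitely many coefficients being nonzero. The
  product is the convolution product over all ways to split a word in two, i.e.\ the bilinear
  extension of concatenation.
\<close>

definition free_alg :: "('k, 'm) ring_scheme \<Rightarrow> ('k, 'v list \<Rightarrow> 'k) module" where
  "free_alg K = \<lparr>
     carrier = {p. range p \<subseteq> carrier K \<and> finite {w. p w \<noteq> \<zero>\<^bsub>K\<^esub>}},
     mult = (\<lambda>p q w. \<Oplus>\<^bsub>K\<^esub>i\<in>{..length w}. p (take i w) \<otimes>\<^bsub>K\<^esub> q (drop i w)),
     one = (\<lambda>w. if w = [] then \<one>\<^bsub>K\<^esub> else \<zero>\<^bsub>K\<^esub>),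
     zero = (\<lambda>w. \<zero>\<^bsub>K\<^esub>),
     add = (\<lambda>p q w. p w \<oplus>\<^bsub>K\<^esub> q w),
     smult = (\<lambda>k p w. k \<otimes>\<^bsub>K\<^esub> p w)\<rparr>"

definition free_gen :: "('k, 'm) ring_scheme \<Rightarrow> 'v \<Rightarrow> 'v list \<Rightarrow> 'k" where
  "free_gen K v = (\<lambda>w. if w = [v] then \<one>\<^bsub>K\<^esub> else \<zero>\<^bsub>K\<^esub>)"


section \<open>Notions for possibly noncommutative algebras\<close>

text \<open>
  The locale \<^locale>\<open>algebra\<close> of the library is restricted to commutative algebras; here an
  algebra is just a record of type \<^type>\<open>module\<close>, which carries both a ring and a scalar
  multiplication.
\<close>

text \<open>
  The library quotient ring, together with the induced scalar multiplication
  \<open>k (I + u) = I + k u\<close>, written as a union over representatives as in \<^const>\<open>rcoset_mult\<close>.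
\<close>

definition quot_alg :: "('k, 'u, 'm) module_scheme \<Rightarrow> 'u set \<Rightarrow> ('k, 'u set) module" where
  "quot_alg A I =
     ring.extend (A Quot I) (module.fields (\<lambda>k S. \<Union>u\<in>S. I +>\<^bsub>A\<^esub> (k \<odot>\<^bsub>A\<^esub> u)))"

definition centre :: "('k, 'u, 'm) module_scheme \<Rightarrow> ('k, 'u, 'm) module_scheme" where
  "centre A =
     A\<lparr>carrier := {z \<in> carrier A. \<forall>u\<in>carrier A. z \<otimes>\<^bsub>A\<^esub> u = u \<otimes>\<^bsub>A\<^esub> z}\<rparr>"

definition alg_iso ::
  "('k, 'l) ring_scheme \<Rightarrow> ('k, 'u, 'm) module_scheme \<Rightarrow> ('k, 'v, 'n) module_scheme \<Rightarrow> ('u \<Rightarrow> 'v) set"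
where
  "alg_iso K A B =
     {h \<in> ring_iso A B. \<forall>k\<in>carrier K. \<forall>u\<in>carrier A. h (k \<odot>\<^bsub>A\<^esub> u) = k \<odot>\<^bsub>B\<^esub> h u}"

text \<open>
  The ring \<open>A\<close> as a left module over (a subring of) itself: the scalar multiplication is replaced
  by the multiplication of \<open>A\<close>.
\<close>

definition mult_module :: "('u, 'm) ring_scheme \<Rightarrow> ('u, 'u) module" where
  "mult_module A = ring.extend (ring.truncate A) (module.fields (mult A))"

definition free_with_basis ::
  "('r, 'l) ring_scheme \<Rightarrow> ('r, 'u, 'm) module_scheme \<Rightarrow> 'u set \<Rightarrow> bool"
where
  "free_with_basis R M B \<longleftrightarrow>
     module R M \<and> B \<subseteq> carrier M \<and> module.span R M B = carrier M \<and> \<not> module.lin_dep R M B"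

definition finite_codim ::
  "('k, 'l) ring_scheme \<Rightarrow> ('k, 'u, 'm) module_scheme \<Rightarrow> 'u set \<Rightarrow> bool"
where
  "finite_codim K A I \<longleftrightarrow>
     vectorspace K (quot_alg A I) \<and> vectorspace.fin_dim K (quot_alg A I)"


section \<open>The algebra given by two quadratic relations\<close>

datatype letter = Letter_x | Letter_y

definition quad_rel :: "('k, 'm) ring_scheme \<Rightarrow> 'v \<Rightarrow> 'k \<Rightarrow> 'k \<Rightarrow> 'v list \<Rightarrow> 'k" where
  "quad_rel K v a b =
     (let A = free_alg K; g = free_gen K v
      in g \<otimes>\<^bsub>A\<^esub> g \<oplus>\<^bsub>A\<^esub> a \<odot>\<^bsub>A\<^esub> g \<oplus>\<^bsub>A\<^esub> b \<odot>\<^bsub>A\<^esub> \<one>\<^bsub>A\<^esub>)"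

text \<open>Note that \<^const>\<open>ideal\<close>, and hence \<^const>\<open>genideal\<close>, is two-sided.\<close>

definition quad_ideal ::
  "('k, 'm) ring_scheme \<Rightarrow> 'k \<Rightarrow> 'k \<Rightarrow> 'k \<Rightarrow> 'k \<Rightarrow> (letter list \<Rightarrow> 'k) set"
where
  "quad_ideal K a b c d =
     Idl\<^bsub>free_alg K\<^esub> {quad_rel K Letter_x a b, quad_rel K Letter_y c d}"

definition quad_alg ::
  "('k, 'm) ring_scheme \<Rightarrow> 'k \<Rightarrow> 'k \<Rightarrow> 'k \<Rightarrow> 'k \<Rightarrow> ('k, (letter list \<Rightarrow> 'k) set) module"
where
  "quad_alg K a b c d = quot_alg (free_alg K) (quad_ideal K a b c d)"

definition quad_gen ::
  "('k, 'm) ring_scheme \<Rightarrow> 'k \<Rightarrow> 'k \<Rightarrow> 'k \<Rightarrow> 'k \<Rightarrow> letter \<Rightarrow> (letter list \<Rightarrow> 'k) set"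
where
  "quad_gen K a b c d v = quad_ideal K a b c d +>\<^bsub>free_alg K\<^esub> free_gen K v"

end

theory Submission
  imports Defs
begin

text \<open>
  Write \<open>F\<close> for the algebra on \<open>x, y\<close> with \<open>x\<^sup>2 + a x + b = 0\<close> and \<open>y\<^sup>2 + c y + d = 0\<close>. The whole
  proof rests on two elements. The element \<open>\<tau> = x y + y x + c x + a y\<close> commutes with \<open>x\<close> and \<open>y\<close>,
  hence is central; up to the constant \<open>a c\<close> it is the trace of \<open>x y\<close>, if \<open>-a - x\<close> and \<open>-c - y\<close> are viewed as
  the conjugates of \<open>x\<close> and \<open>y\<close>. The commutator \<open>w = x y - y x\<close> has the square
  \<open>\<Delta> = \<tau>\<^sup>2 + a c \<tau> + a\<^sup>2 d + b c\<^sup>2 - 4 b d\<close>, a polynomial in \<open>\<tau>\<close> that is monic of degree two and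
  therefore nonzero in every characteristic. So \<open>F\<close> is an order in a generalised quaternion algebra
  over \<open>K(\<tau>)\<close>.

  Normal form. Solving the definition of \<open>\<tau>\<close> for \<open>y x\<close> turns every word into a combination
  \<open>p + q x + r y + s x y\<close> with \<open>p, q, r, s \<in> K[\<tau>]\<close>. To see that the four coefficients are unique,
  and that \<open>\<tau>\<close> is transcendental over \<open>K\<close>, let \<open>x\<close> and \<open>y\<close> act on \<open>K[X]\<^sup>4\<close> by the formulas that
  describe left multiplication on these combinations. The two quadratic relations hold for these
  operators, so there is a map from \<open>F\<close> to \<open>K[X]\<^sup>4\<close> that sends \<open>1\<close> to the first unit vector and
  intertwines left multiplication with the action, and it reads off the coefficients. This is
  \<open>\<Phi>_surj\<close> and \<open>\<Phi>_inj\<close>.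

  Centre and ideals. For \<open>u = p + q x + r y + s x y\<close> the commutator with \<open>x\<close> is
  \<open>x u - u x = (r + s x) w\<close>, so a further factor \<open>w\<close> gives \<open>\<Delta> r + \<Delta> s x\<close>; in the same way
  \<open>(p + q x) y - y (p + q x) = q w\<close>. If \<open>u\<close> is central all these elements vanish, so
  \<open>q = r = s = 0\<close>, and the centre is \<open>K[\<tau>]\<close>. If \<open>u\<close> is a nonzero element of an ideal, the same
  elements lie in the ideal and one of them is, or leads to, a nonzero element \<open>f(\<tau>)\<close> of \<open>K[\<tau>]\<close>.
  Division by \<open>f\<close> then shows that the quotient is spanned by the classes of \<open>\<tau>\<^sup>i e\<close> with
  \<open>i < deg f\<close> and \<open>e\<close> one of \<open>1, x, y, x y\<close>.
\<close>

section \<open>Unital algebras over a commutative ring\<close>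

locale unital_algebra = module K A + A?: ring A for K and A (structure) +
  assumes smult_mult_left:
      "\<lbrakk>k \<in> carrier K; u \<in> carrier A; v \<in> carrier A\<rbrakk> \<Longrightarrow> (k \<odot> u) \<otimes> v = k \<odot> (u \<otimes> v)"
    and smult_mult_right:
      "\<lbrakk>k \<in> carrier K; u \<in> carrier A; v \<in> carrier A\<rbrakk> \<Longrightarrow> u \<otimes> (k \<odot> v) = k \<odot> (u \<otimes> v)"

section \<open>The free algebra\<close>

context ring
begin

abbreviation conv where "conv \<equiv> mult (free_alg R)"

lemma conv_Nil:
  "\<lbrakk>p [] \<in> carrier R; q [] \<in> carrier R\<rbrakk> \<Longrightarrow> conv p q [] = p [] \<otimes> q []"
  by (simp add: free_alg_def)

lemma conv_closed:
  "\<lbrakk>\<And>w. p w \<in> carrier R; \<And>w. q w \<in> carrier R\<rbrakk> \<Longrightarrow> conv p q w \<in> carrier R"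
  by (simp add: free_alg_def)

text \<open>
  Splitting off the first letter \<open>v\<close> replaces the left factor by its left derivative, the
  function \<open>u \<mapsto> p (v # u)\<close>. This recursion turns associativity into an induction on the word in
  which only linearity is used, and no double sum has to be reindexed.
\<close>

lemma conv_Cons:
  assumes "\<And>w. p w \<in> carrier R" "\<And>w. q w \<in> carrier R"
  shows "conv p q (v # w) = conv (\<lambda>u. p (v # u)) q w \<oplus> p [] \<otimes> q (v # w)"
  using assms by (simp add: free_alg_def finsum_Suc2 del: finsum_Suc)

lemma conv_add_left:
  assumes "\<And>w. p w \<in> carrier R" "\<And>w. q w \<in> carrier R" "\<And>w. r w \<in> carrier R"
  shows "conv (\<lambda>u. p u \<oplus> q u) r w = conv p r w \<oplus> conv q r w"
  using assms by (simp add: free_alg_def l_distr finsum_addf)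

lemma conv_add_right:
  assumes "\<And>w. p w \<in> carrier R" "\<And>w. q w \<in> carrier R" "\<And>w. r w \<in> carrier R"
  shows "conv r (\<lambda>u. p u \<oplus> q u) w = conv r p w \<oplus> conv r q w"
  using assms by (simp add: free_alg_def r_distr finsum_addf)

lemma conv_smult_left:
  assumes "k \<in> carrier R" "\<And>w. p w \<in> carrier R" "\<And>w. q w \<in> carrier R"
  shows "conv (\<lambda>u. k \<otimes> p u) q w = k \<otimes> conv p q w"
  using assms by (simp add: free_alg_def m_assoc finsum_rdistr Pi_def)

lemma conv_zero_left:
  assumes "\<And>w. q w \<in> carrier R"
  shows "conv (\<lambda>u. \<zero>) q w = \<zero>"
  using assms by (simp add: free_alg_def)

lemma conv_one_left:
  assumes "\<And>w. q w \<in> carrier R"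
  shows "conv (\<lambda>u. if u = [] then \<one> else \<zero>) q w = q w"
  using assms by (cases w) (simp_all add: conv_Nil conv_Cons conv_zero_left)

lemma conv_one_right:
  assumes "\<And>w. p w \<in> carrier R"
  shows "conv p (\<lambda>u. if u = [] then \<one> else \<zero>) w = p w"
  using assms by (induction w arbitrary: p) (simp_all add: conv_Nil conv_Cons)

text \<open>
  The derivative of a product is again a sum of products, so the induction hypothesis is needed
  for all left factors.
\<close>

lemma conv_assoc:
  assumes "\<And>w. p w \<in> carrier R" "\<And>w. q w \<in> carrier R" "\<And>w. r w \<in> carrier R"
  shows "conv (conv p q) r w = conv p (conv q r) w"
  using assms(1)
proof (induction w arbitrary: p)
  case Nil
  then show ?case using assms(2-3) by (simp add: conv_Nil conv_closed m_assoc)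
next
  case (Cons v w)
  note cl = Cons.prems assms(2-3)
  have "conv (conv p q) r (v # w)
      = conv (\<lambda>u. conv (\<lambda>u. p (v # u)) q u \<oplus> p [] \<otimes> q (v # u)) r w
        \<oplus> (p [] \<otimes> q []) \<otimes> r (v # w)"
    using cl by (simp add: conv_Cons conv_closed conv_Nil)
  also have "\<dots> = (conv (\<lambda>u. p (v # u)) (conv q r) w \<oplus> p [] \<otimes> conv (\<lambda>u. q (v # u)) r w)
        \<oplus> (p [] \<otimes> q []) \<otimes> r (v # w)"
    using cl by (simp add: conv_add_left conv_smult_left conv_closed Cons.IH)
  also have "\<dots> = conv p (conv q r) (v # w)"
    using cl by (simp add: conv_Cons conv_closed a_assoc r_distr m_assoc)
  finally show ?case .
qed

lemma finite_support_conv: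
  assumes "\<And>w. p w \<in> carrier R" "\<And>w. q w \<in> carrier R"
    and "finite {w. p w \<noteq> \<zero>}" "finite {w. q w \<noteq> \<zero>}"
  shows "finite {w. conv p q w \<noteq> \<zero>}"
proof (rule finite_subset)
  show "{w. conv p q w \<noteq> \<zero>} \<subseteq> (\<lambda>(u, v). u @ v) ` ({w. p w \<noteq> \<zero>} \<times> {w. q w \<noteq> \<zero>})"
  proof
    fix w assume w: "w \<in> {w. conv p q w \<noteq> \<zero>}"
    have "\<exists>i. p (take i w) \<otimes> q (drop i w) \<noteq> \<zero>"
    proof (rule ccontr)
      assume "\<not> ?thesis"
      then have "conv p q w = \<zero>"
        by (simp add: free_alg_def)
      then show False using w by simp
    qed
    then obtain i where i: "p (take i w) \<otimes> q (drop i w) \<noteq> \<zero>" ..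
    then have "p (take i w) \<noteq> \<zero>" "q (drop i w) \<noteq> \<zero>"
      using assms(1,2) by auto
    then show "w \<in> (\<lambda>(u, v). u @ v) ` ({w. p w \<noteq> \<zero>} \<times> {w. q w \<noteq> \<zero>})"
      by (auto intro!: image_eqI[where x = "(take i w, drop i w)"])
  qed
qed (use assms in simp)

end

lemma free_alg_simps:
  "p \<in> carrier (free_alg K) \<longleftrightarrow> (\<forall>w. p w \<in> carrier K) \<and> finite {w. p w \<noteq> \<zero>\<^bsub>K\<^esub>}"
  "\<one>\<^bsub>free_alg K\<^esub> = (\<lambda>w. if w = [] then \<one>\<^bsub>K\<^esub> else \<zero>\<^bsub>K\<^esub>)"
  "\<zero>\<^bsub>free_alg K\<^esub> = (\<lambda>w. \<zero>\<^bsub>K\<^esub>)"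
  "p \<oplus>\<^bsub>free_alg K\<^esub> q = (\<lambda>w. p w \<oplus>\<^bsub>K\<^esub> q w)"
  "k \<odot>\<^bsub>free_alg K\<^esub> p = (\<lambda>w. k \<otimes>\<^bsub>K\<^esub> p w)"
  by (auto simp: free_alg_def)

lemma (in cring) conv_smult_right:
  assumes "k \<in> carrier R" "\<And>w. p w \<in> carrier R" "\<And>w. q w \<in> carrier R"
  shows "conv p (\<lambda>u. k \<otimes> q u) w = k \<otimes> conv p q w"
  using assms by (simp add: free_alg_def m_lcomm finsum_rdistr Pi_def)

lemma (in ring) finite_support_add:
  assumes "finite {w. p w \<noteq> \<zero>}" "finite {w. q w \<noteq> \<zero>}"
  shows "finite {w. p w \<oplus> q w \<noteq> \<zero>}"
  by (rule finite_subset[of _ "{w. p w \<noteq> \<zero>} \<union> {w. q w \<noteq> \<zero>}"]) (use assms in auto)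

lemma (in ring) finite_support_smult:
  assumes "finite {w. p w \<noteq> \<zero>}" "k \<in> carrier R"
  shows "finite {w. k \<otimes> p w \<noteq> \<zero>}"
  by (rule finite_subset[of _ "{w. p w \<noteq> \<zero>}"]) (use assms in auto)

theorem (in cring) free_alg_unital_algebra: "unital_algebra R (free_alg R)"
proof -
  let ?A = "free_alg R"
  have ag: "abelian_group ?A"
  proof (rule abelian_groupI)
    fix p assume p: "p \<in> carrier ?A"
    have "{w. \<ominus> p w \<noteq> \<zero>} = {w. p w \<noteq> \<zero>}"
      using p by (auto simp: free_alg_simps)
    then show "\<exists>q\<in>carrier ?A. q \<oplus>\<^bsub>?A\<^esub> p = \<zero>\<^bsub>?A\<^esub>"
      using p by (intro bexI[of _ "\<lambda>w. \<ominus> p w"]) (auto simp: free_alg_simps l_neg)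
  qed (auto simp: free_alg_simps finite_support_add a_assoc intro!: ext intro: a_comm)
  have mon: "Group.monoid ?A"
    by (rule monoidI)
      (auto simp: free_alg_simps conv_closed finite_support_conv conv_one_left conv_one_right
        intro!: ext conv_assoc)
  have ring: "ring ?A"
    by (rule ringI[OF ag mon])
      (auto simp: free_alg_simps conv_add_left conv_add_right intro!: ext)
  have mod: "module R ?A"
    by (rule moduleI[OF is_cring ag])
      (auto simp: free_alg_simps finite_support_smult l_distr r_distr m_assoc)
  show ?thesis
    by (intro unital_algebra.intro ring mod unital_algebra_axioms.intro)
      (auto simp: free_alg_simps conv_smult_left conv_smult_right intro!: ext)
qed

lemma (in ring) conv_gen_left:
  assumes "\<And>w. q w \<in> carrier R"
  shows "conv (free_gen R v) q w
    = (case w of [] \<Rightarrow> \<zero> | u # w' \<Rightarrow> if u = v then q w' else \<zero>)"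
proof (cases w)
  case Nil
  then show ?thesis using assms by (simp add: conv_Nil free_gen_def)
next
  case (Cons u w')
  have eq: "(\<lambda>z. free_gen R v (u # z))
      = (if u = v then (\<lambda>z. if z = [] then \<one> else \<zero>) else (\<lambda>z. \<zero>))"
    by (auto simp: free_gen_def fun_eq_iff)
  have "conv (free_gen R v) q (u # w')
      = conv (\<lambda>z. free_gen R v (u # z)) q w' \<oplus> free_gen R v [] \<otimes> q (u # w')"
    using assms by (intro conv_Cons) (simp_all add: free_gen_def)
  then show ?thesis using assms
    by (simp add: Cons eq conv_one_left conv_zero_left) (simp add: free_gen_def)
qed

lemma (in ring) free_gen_closed: "free_gen R v \<in> carrier (free_alg R)"
  by (simp add: free_alg_simps free_gen_def)

text \<open>
  Words are built from the empty word by adding letters on the left, so it is enough to treat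
  left multiplication by a letter; the general element is then reached by induction on a finite
  set containing its support.
\<close>

lemma (in cring) free_alg_induct [consumes 1, case_names one add smult gen]:
  assumes p: "p \<in> carrier (free_alg R)"
    and one: "P \<one>\<^bsub>free_alg R\<^esub>"
    and add: "\<And>p q. \<lbrakk>p \<in> carrier (free_alg R); q \<in> carrier (free_alg R); P p; P q\<rbrakk>
      \<Longrightarrow> P (p \<oplus>\<^bsub>free_alg R\<^esub> q)"
    and smult: "\<And>k p. \<lbrakk>k \<in> carrier R; p \<in> carrier (free_alg R); P p\<rbrakk>
      \<Longrightarrow> P (k \<odot>\<^bsub>free_alg R\<^esub> p)"
    and gen: "\<And>v p. \<lbrakk>p \<in> carrier (free_alg R); P p\<rbrakk> \<Longrightarrow> P (conv (free_gen R v) p)"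
  shows "P p"
proof -
  interpret A: unital_algebra R "free_alg R :: ('a, 'c list \<Rightarrow> 'a) module"
    by (rule free_alg_unital_algebra)
  define m where "m w = (\<lambda>u. if u = w then \<one> else \<zero>)" for w :: "'c list"
  have m_cl: "m w \<in> carrier (free_alg R)" for w
    by (simp add: free_alg_simps m_def)
  have m_P: "P (m w)" for w
  proof (induction w)
    case Nil
    then show ?case using one by (simp add: m_def free_alg_simps)
  next
    case (Cons v w)
    have "m (v # w) = conv (free_gen R v) (m w)"
      by (rule ext, subst conv_gen_left) (auto simp: m_def split: list.splits)
    then show ?case using gen[OF m_cl Cons.IH] by simp
  qed
  have "\<forall>p\<in>carrier (free_alg R). {w. p w \<noteq> \<zero>} \<subseteq> S \<longrightarrow> P p" if "finite S" for S
    using that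
  proof (induction S)
    case empty
    show ?case
    proof (intro ballI impI)
      fix p :: "'c list \<Rightarrow> 'a" assume "{w. p w \<noteq> \<zero>} \<subseteq> {}"
      then have "p = \<zero> \<odot>\<^bsub>free_alg R\<^esub> \<one>\<^bsub>free_alg R\<^esub>"
        by (auto simp: free_alg_simps)
      then show "P p" using smult[OF zero_closed A.one_closed one] by simp
    qed
  next
    case (insert v S)
    show ?case
    proof (intro ballI impI)
      fix p assume p: "p \<in> carrier (free_alg R)" and supp: "{w. p w \<noteq> \<zero>} \<subseteq> insert v S"
      define q where "q = p(v := \<zero>)"
      have "{w. q w \<noteq> \<zero>} \<subseteq> {w. p w \<noteq> \<zero>}" by (auto simp: q_def)
      then have q: "q \<in> carrier (free_alg R)"
        using p by (auto simp: free_alg_simps q_def intro: finite_subset)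
      have "p = p v \<odot>\<^bsub>free_alg R\<^esub> m v \<oplus>\<^bsub>free_alg R\<^esub> q"
        using p by (auto simp: free_alg_simps q_def m_def)
      moreover have "{w. q w \<noteq> \<zero>} \<subseteq> S" using supp by (auto simp: q_def)
      then have "P q" using insert.IH q by blast
      moreover have "p v \<in> carrier R" using p by (simp add: free_alg_simps)
      ultimately show "P p"
        using add[OF A.smult_closed q smult[OF _ m_cl m_P]] m_cl by metis
    qed
  qed
  then show ?thesis using p by (auto simp: free_alg_simps)
qed

lemma (in mod_hom) hom_finsum:
  "g \<in> S \<rightarrow> carrier M \<Longrightarrow> f (finsum M g S) = (\<Oplus>\<^bsub>N\<^esub>s\<in>S. f (g s))"
  by (induction S rule: infinite_finite_induct) (auto simp: Pi_def)

text \<open>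
  The free algebra is a free object also for modules with operators: a word acts by composing
  the operators of its letters, and \<open>\<Psi> p\<close> is the result of applying \<open>p\<close> to \<open>\<xi>\<close>. Using a module
  as the target, and not an algebra, means that no multiplication on the target has to be
  constructed and shown to be associative.
\<close>

theorem (in cring) free_alg_lift_module:
  assumes V: "module R V" and \<xi>: "\<xi> \<in> carrier V"
    and L: "\<And>v. L v \<in> module_hom R V V"
  shows "\<exists>\<Psi>\<in>module_hom R (free_alg R) V. \<Psi> \<one>\<^bsub>free_alg R\<^esub> = \<xi> \<and>
    (\<forall>v. \<forall>p\<in>carrier (free_alg R). \<Psi> (conv (free_gen R v) p) = L v (\<Psi> p))"
proof -
  interpret V: module R V by fact
  have L_hom: "mod_hom R V V (L v)" for v
    using L V by (simp add: mod_hom_def mod_hom_axioms_def)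
  define act where "act w = foldr L w \<xi>" for w
  have act: "act w \<in> carrier V" for w
    by (induction w) (auto simp: act_def \<xi> mod_hom.f_im[OF L_hom])
  define \<Psi> where "\<Psi> p = (\<Oplus>\<^bsub>V\<^esub>w\<in>{w. p w \<noteq> \<zero>}. p w \<odot>\<^bsub>V\<^esub> act w)" for p
  have \<Psi>_eq: "\<Psi> p = (\<Oplus>\<^bsub>V\<^esub>w\<in>S. p w \<odot>\<^bsub>V\<^esub> act w)"
    if "p \<in> carrier (free_alg R)" "finite S" "{w. p w \<noteq> \<zero>} \<subseteq> S" for p S
    unfolding \<Psi>_def using that act
    by (intro V.add.finprod_mono_neutral_cong_left) (auto simp: free_alg_simps)
  have hom: "\<Psi> \<in> module_hom R (free_alg R) V"
    unfolding module_hom_def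
  proof (intro CollectI conjI allI impI, goal_cases)
    case 1
    then show ?case using act by (auto simp: \<Psi>_def free_alg_simps)
  next
    case (2 p q)
    let ?S = "{w. p w \<noteq> \<zero>} \<union> {w. q w \<noteq> \<zero>}"
    have fin: "finite ?S" using 2 by (simp add: free_alg_simps)
    have pq: "p \<oplus>\<^bsub>free_alg R\<^esub> q \<in> carrier (free_alg R)"
      using 2 by (simp add: free_alg_simps finite_support_add)
    have "{w. (p \<oplus>\<^bsub>free_alg R\<^esub> q) w \<noteq> \<zero>} \<subseteq> ?S"
      using 2 by (auto simp: free_alg_simps)
    then have "\<Psi> (p \<oplus>\<^bsub>free_alg R\<^esub> q) = (\<Oplus>\<^bsub>V\<^esub>w\<in>?S. (p \<oplus>\<^bsub>free_alg R\<^esub> q) w \<odot>\<^bsub>V\<^esub> act w)"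
      using pq fin by (intro \<Psi>_eq)
    also have "\<dots> = (\<Oplus>\<^bsub>V\<^esub>w\<in>?S. p w \<odot>\<^bsub>V\<^esub> act w \<oplus>\<^bsub>V\<^esub> q w \<odot>\<^bsub>V\<^esub> act w)"
      using 2 act by (intro V.finsum_cong') (auto simp: free_alg_simps V.smult_l_distr)
    also have "\<dots> = \<Psi> p \<oplus>\<^bsub>V\<^esub> \<Psi> q"
      using 2 act fin \<Psi>_eq[of p ?S] \<Psi>_eq[of q ?S]
      by (subst V.finsum_addf) (auto simp: free_alg_simps)
    finally show ?case .
  next
    case (3 k p)
    let ?S = "{w. p w \<noteq> \<zero>}"
    have kp: "k \<odot>\<^bsub>free_alg R\<^esub> p \<in> carrier (free_alg R)"
      using 3 by (simp add: free_alg_simps finite_support_smult)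
    have "{w. (k \<odot>\<^bsub>free_alg R\<^esub> p) w \<noteq> \<zero>} \<subseteq> ?S"
      using 3 by (auto simp: free_alg_simps)
    then have "\<Psi> (k \<odot>\<^bsub>free_alg R\<^esub> p) = (\<Oplus>\<^bsub>V\<^esub>w\<in>?S. (k \<odot>\<^bsub>free_alg R\<^esub> p) w \<odot>\<^bsub>V\<^esub> act w)"
      using kp 3 by (intro \<Psi>_eq) (auto simp: free_alg_simps)
    also have "\<dots> = (\<Oplus>\<^bsub>V\<^esub>w\<in>?S. k \<odot>\<^bsub>V\<^esub> (p w \<odot>\<^bsub>V\<^esub> act w))"
      using 3 act by (intro V.finsum_cong') (auto simp: free_alg_simps V.smult_assoc1)
    also have "\<dots> = k \<odot>\<^bsub>V\<^esub> \<Psi> p"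
      unfolding \<Psi>_def using 3 act
      by (intro V.finsum_smult[symmetric]) (auto simp: free_alg_simps)
    finally show ?case .
  qed
  have one: "\<Psi> \<one>\<^bsub>free_alg R\<^esub> = \<xi>"
  proof -
    have "\<Psi> \<one>\<^bsub>free_alg R\<^esub> = (\<Oplus>\<^bsub>V\<^esub>w\<in>{[]}. \<one>\<^bsub>free_alg R\<^esub> w \<odot>\<^bsub>V\<^esub> act w)"
      by (rule \<Psi>_eq) (auto simp: free_alg_simps)
    then show ?thesis using \<xi> by (simp add: free_alg_simps act_def)
  qed
  have gen: "\<Psi> (conv (free_gen R v) p) = L v (\<Psi> p)" if p: "p \<in> carrier (free_alg R)" for v p
  proof -
    interpret L: mod_hom R V V "L v" by (rule L_hom)
    have gp: "conv (free_gen R v) p = (\<lambda>w. case w of [] \<Rightarrow> \<zero> | u # w' \<Rightarrow> if u = v then p w' else \<zero>)"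
      using p by (auto simp: conv_gen_left free_alg_simps)
    have supp: "{w. conv (free_gen R v) p w \<noteq> \<zero>} = (#) v ` {w. p w \<noteq> \<zero>}"
    proof (rule Set.set_eqI)
      show "w \<in> {w. conv (free_gen R v) p w \<noteq> \<zero>} \<longleftrightarrow> w \<in> (#) v ` {w. p w \<noteq> \<zero>}" for w
        unfolding gp by (cases w) auto
    qed
    have "\<Psi> (conv (free_gen R v) p)
        = (\<Oplus>\<^bsub>V\<^esub>w\<in>(#) v ` {w. p w \<noteq> \<zero>}. conv (free_gen R v) p w \<odot>\<^bsub>V\<^esub> act w)"
      unfolding \<Psi>_def supp ..
    also have "\<dots> = (\<Oplus>\<^bsub>V\<^esub>w\<in>{w. p w \<noteq> \<zero>}. p w \<odot>\<^bsub>V\<^esub> act (v # w))"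
      using p act by (subst V.add.finprod_reindex) (auto simp: gp free_alg_simps)
    also have "\<dots> = (\<Oplus>\<^bsub>V\<^esub>w\<in>{w. p w \<noteq> \<zero>}. L v (p w \<odot>\<^bsub>V\<^esub> act w))"
      using p act by (intro V.finsum_cong') (auto simp: free_alg_simps act_def L.f_smult)
    also have "\<dots> = L v (\<Psi> p)"
      unfolding \<Psi>_def using p act
      by (intro L.hom_finsum[symmetric]) (auto simp: free_alg_simps)
    finally show ?thesis .
  qed
  show ?thesis using hom one gen by blast
qed

section \<open>Quotients\<close>

text \<open>
  Being a ring depends on the five ring fields only, so the property passes between records with
  different further fields.
\<close>

lemma ring_cong:
  assumes "carrier B = carrier A" "mult B = mult A" "\<one>\<^bsub>B\<^esub> = \<one>\<^bsub>A\<^esub>"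
    "add B = add A" "\<zero>\<^bsub>B\<^esub> = \<zero>\<^bsub>A\<^esub>"
  shows "ring B \<longleftrightarrow> ring A"
  unfolding ring_def abelian_group_def abelian_monoid_def abelian_group_axioms_def
    comm_group_def comm_monoid_def comm_monoid_axioms_def Group.group_def group_axioms_def
    Units_def Group.monoid_def ring_axioms_def partial_object.simps monoid.simps assms
  by (rule refl)

lemma quot_alg_simps:
  "carrier (quot_alg A I) = (\<lambda>u. I +>\<^bsub>A\<^esub> u) ` carrier A"
  "mult (quot_alg A I) = rcoset_mult A I"
  "add (quot_alg A I) = set_add A"
  "\<zero>\<^bsub>quot_alg A I\<^esub> = I"
  "\<one>\<^bsub>quot_alg A I\<^esub> = I +>\<^bsub>A\<^esub> \<one>\<^bsub>A\<^esub>"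
  by (auto simp: quot_alg_def ring.defs module.defs FactRing_def A_RCOSETS_def' a_r_coset_def r_coset_def)

context unital_algebra
begin

context
  fixes I assumes I: "ideal I A"
begin

interpretation I: ideal I A by (rule I)

lemma quot_alg_coset:
  assumes "u \<in> carrier A" "v \<in> carrier A"
  shows "(I +> u) \<otimes>\<^bsub>quot_alg A I\<^esub> (I +> v) = I +> (u \<otimes> v)"
    and "(I +> u) \<oplus>\<^bsub>quot_alg A I\<^esub> (I +> v) = I +> (u \<oplus> v)"
  using assms by (simp_all add: quot_alg_simps I.rcoset_mult_add I.a_rcos_sum)

lemma quot_alg_smult:
  assumes k: "k \<in> carrier K" and u: "u \<in> carrier A"
  shows "k \<odot>\<^bsub>quot_alg A I\<^esub> (I +> u) = I +> (k \<odot> u)"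
proof -
  \<comment> \<open>All members of the union are equal, because \<open>k i = (k 1) i\<close> lies in \<open>I\<close> for \<open>i \<in> I\<close>.\<close>
  have eq: "I +> (k \<odot> v) = I +> (k \<odot> u)" if v: "v \<in> I +> u" for v
  proof -
    obtain i where i: "i \<in> I" "v = i \<oplus> u"
      using v by (auto simp: a_r_coset_def')
    have "k \<odot> i = (k \<odot> \<one>) \<otimes> i"
      using k i(1) I.Icarr by (simp add: smult_mult_left)
    then have "k \<odot> i \<in> I" using k i(1) by (simp add: I.I_l_closed)
    moreover have "k \<odot> v = k \<odot> i \<oplus> k \<odot> u"
      using i k u I.Icarr by (simp add: smult_r_distr)
    ultimately have "k \<odot> v \<in> I +> (k \<odot> u)" by (auto simp: a_r_coset_def')
    then show ?thesis
      using k u M.a_repr_independence[OF _ _ I.a_subgroup] by (metis smult_closed)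
  qed
  have "k \<odot>\<^bsub>quot_alg A I\<^esub> (I +> u) = (\<Union>v\<in>I +> u. I +> (k \<odot> v))"
    by (simp add: quot_alg_def ring.defs module.defs)
  also have "\<dots> = (\<Union>v\<in>I +> u. I +> (k \<odot> u))"
    by (rule SUP_cong) (simp_all only: eq)
  also have "\<dots> = I +> (k \<odot> u)"
    using I.a_rcos_self[OF u] by blast
  finally show ?thesis .
qed

lemma quot_alg_eq_zero_iff:
  "u \<in> carrier A \<Longrightarrow> I +> u = \<zero>\<^bsub>quot_alg A I\<^esub> \<longleftrightarrow> u \<in> I"
  using I.a_rcos_const I.a_rcos_self by (auto simp: quot_alg_simps)

theorem quot_alg_unital_algebra: "unital_algebra K (quot_alg A I)"
proof -
  have ring: "ring (quot_alg A I)"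
    by (rule iffD2[OF ring_cong I.quotient_is_ring])
      (simp_all add: quot_alg_def ring.defs module.defs)
  interpret Q: ring "quot_alg A I" by (rule ring)
  have mod: "module K (quot_alg A I)"
    by (rule moduleI[OF R.is_cring Q.is_abelian_group])
      (auto simp: quot_alg_simps(1) quot_alg_smult quot_alg_coset smult_l_distr smult_r_distr
        smult_assoc1)
  show ?thesis
    by (intro unital_algebra.intro ring mod unital_algebra_axioms.intro)
      (auto simp: quot_alg_simps(1) quot_alg_smult quot_alg_coset smult_mult_left smult_mult_right)
qed

end

end

section \<open>Centres\<close>

lemma centre_simps [simp]:
  "mult (centre A) = mult A" "\<one>\<^bsub>centre A\<^esub> = \<one>\<^bsub>A\<^esub>"
  "add (centre A) = add A" "\<zero>\<^bsub>centre A\<^esub> = \<zero>\<^bsub>A\<^esub>"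
  "smult (centre A) = smult A"
  by (simp_all add: centre_def)

lemma mem_centreI:
  "\<lbrakk>z \<in> carrier A; \<And>u. u \<in> carrier A \<Longrightarrow> z \<otimes>\<^bsub>A\<^esub> u = u \<otimes>\<^bsub>A\<^esub> z\<rbrakk> \<Longrightarrow> z \<in> carrier (centre A)"
  by (simp add: centre_def)

lemma centre_closed: "z \<in> carrier (centre A) \<Longrightarrow> z \<in> carrier A"
  by (simp add: centre_def)

lemma centre_commute:
  "\<lbrakk>z \<in> carrier (centre A); u \<in> carrier A\<rbrakk> \<Longrightarrow> z \<otimes>\<^bsub>A\<^esub> u = u \<otimes>\<^bsub>A\<^esub> z"
  by (simp add: centre_def)

lemma mult_module_simps [simp]:
  "carrier (mult_module A) = carrier A"
  "add (mult_module A) = add A" "\<zero>\<^bsub>mult_module A\<^esub> = \<zero>\<^bsub>A\<^esub>"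
  "smult (mult_module A) = mult A"
  by (simp_all add: mult_module_def ring.defs module.defs)

context unital_algebra
begin

lemma centre_left_commute:
  assumes "z \<in> carrier (centre A)" "u \<in> carrier A" "v \<in> carrier A"
  shows "u \<otimes> (z \<otimes> v) = z \<otimes> (u \<otimes> v)"
  using assms centre_commute[of z A u] centre_closed[of z A]
  by (simp flip: A.m_assoc)

lemma smult_one_in_centre:
  "k \<in> carrier K \<Longrightarrow> k \<odot> \<one> \<in> carrier (centre A)"
  by (rule mem_centreI) (simp_all add: smult_mult_left smult_mult_right)

lemma centre_zero_closed: "\<zero> \<in> carrier (centre A)"
  and centre_one_closed: "\<one> \<in> carrier (centre A)"
  by (simp_all add: mem_centreI)

lemma centre_add_closed:
  assumes "y \<in> carrier (centre A)" "z \<in> carrier (centre A)"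
  shows "y \<oplus> z \<in> carrier (centre A)"
  using assms[THEN centre_closed] assms[THEN centre_commute]
  by (intro mem_centreI) (simp_all add: A.l_distr A.r_distr)

lemma centre_mult_closed:
  assumes "y \<in> carrier (centre A)" "z \<in> carrier (centre A)"
  shows "y \<otimes> z \<in> carrier (centre A)"
proof (rule mem_centreI)
  fix u assume u: "u \<in> carrier A"
  show "y \<otimes> z \<otimes> u = u \<otimes> (y \<otimes> z)"
    using assms(1,2)[THEN centre_closed] centre_commute[OF assms(2) u]
      centre_left_commute[OF assms(1) u, of z] u
    by (simp add: A.m_assoc)
qed (use assms[THEN centre_closed] in simp)

lemma centre_a_inv_closed:
  assumes "z \<in> carrier (centre A)"
  shows "\<ominus> z \<in> carrier (centre A)"
  using centre_closed[OF assms] centre_commute[OF assms]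
  by (intro mem_centreI) (simp_all add: A.l_minus A.r_minus)

lemma centre_cring: "cring (centre A)"
proof (rule cringI)
  show "abelian_group (centre A)"
  proof (rule abelian_groupI)
    fix z assume z: "z \<in> carrier (centre A)"
    then show "\<exists>z'\<in>carrier (centre A). z' \<oplus>\<^bsub>centre A\<^esub> z = \<zero>\<^bsub>centre A\<^esub>"
      using centre_closed[OF z] centre_a_inv_closed[OF z]
      by (intro bexI[of _ "\<ominus> z"]) (simp_all add: M.l_neg)
  qed (auto simp: centre_add_closed centre_closed M.a_assoc centre_zero_closed intro: M.a_comm)
  show "comm_monoid (centre A)"
    by (rule comm_monoidI)
      (auto simp: centre_mult_closed centre_closed A.m_assoc centre_one_closed intro: centre_commute)
qed (simp add: centre_closed A.l_distr)

lemma centre_mult_module: "module (centre A) (mult_module A)"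
proof -
  have "ring (mult_module A)"
    by (rule iffD2[OF ring_cong A.ring_axioms]) (simp_all add: mult_module_def ring.defs module.defs)
  then show ?thesis
    by (intro moduleI centre_cring ring.is_abelian_group)
      (simp_all add: centre_closed A.l_distr A.r_distr A.m_assoc)
qed

end

section \<open>Modules over the algebra with two quadratic relations\<close>

locale two_quadratics = K?: cring K for K (structure) +
  fixes a b c d
  assumes coeffs [simp, intro]: "a \<in> carrier K" "b \<in> carrier K" "c \<in> carrier K" "d \<in> carrier K"
begin

abbreviation "Free \<equiv> free_alg K :: ('a, letter list \<Rightarrow> 'a) module"
abbreviation "Rel \<equiv> quad_ideal K a b c d"

sublocale Free: unital_algebra K Free
  by (rule free_alg_unital_algebra)

lemma quad_rel_closed:
  "\<lbrakk>k \<in> carrier K; l \<in> carrier K\<rbrakk> \<Longrightarrow> quad_rel K v k l \<in> carrier Free"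
  by (simp add: quad_rel_def Let_def free_gen_closed)

lemma quad_rels_subset: "{quad_rel K Letter_x a b, quad_rel K Letter_y c d} \<subseteq> carrier Free"
  using quad_rel_closed by simp

lemma ideal_Rel: "ideal Rel Free"
  unfolding quad_ideal_def by (rule Free.A.genideal_ideal[OF quad_rels_subset])

lemma quad_alg_unital_algebra: "unital_algebra K (quad_alg K a b c d)"
  unfolding quad_alg_def by (rule Free.quot_alg_unital_algebra[OF ideal_Rel])

lemma quad_gen_closed: "quad_gen K a b c d v \<in> carrier (quad_alg K a b c d)"
  by (simp add: quad_gen_def quad_alg_def quot_alg_simps free_gen_closed)

lemma quad_gen_relation:
  assumes v: "v = Letter_x \<and> k = a \<and> l = b \<or> v = Letter_y \<and> k = c \<and> l = d"
  defines "F \<equiv> quad_alg K a b c d" and "g \<equiv> quad_gen K a b c d v"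
  shows "g \<otimes>\<^bsub>F\<^esub> g \<oplus>\<^bsub>F\<^esub> k \<odot>\<^bsub>F\<^esub> g \<oplus>\<^bsub>F\<^esub> l \<odot>\<^bsub>F\<^esub> \<one>\<^bsub>F\<^esub> = \<zero>\<^bsub>F\<^esub>"
proof -
  have kl: "k \<in> carrier K" "l \<in> carrier K" using v by auto
  have "quad_rel K v k l \<in> Rel"
    unfolding quad_ideal_def using Free.A.genideal_self[OF quad_rels_subset] v by blast
  then have "Rel +>\<^bsub>Free\<^esub> quad_rel K v k l = \<zero>\<^bsub>F\<^esub>"
    unfolding F_def quad_alg_def
    using Free.quot_alg_eq_zero_iff[OF ideal_Rel] quad_rel_closed kl by simp
  moreover have "Rel +>\<^bsub>Free\<^esub> quad_rel K v k l
      = g \<otimes>\<^bsub>F\<^esub> g \<oplus>\<^bsub>F\<^esub> k \<odot>\<^bsub>F\<^esub> g \<oplus>\<^bsub>F\<^esub> l \<odot>\<^bsub>F\<^esub> \<one>\<^bsub>F\<^esub>"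
    unfolding F_def g_def quad_alg_def quad_gen_def quad_rel_def Let_def
    using kl by (simp add: Free.quot_alg_coset[OF ideal_Rel] Free.quot_alg_smult[OF ideal_Rel]
        free_gen_closed quot_alg_simps(5))
  ultimately show ?thesis by simp
qed

text \<open>
  Every element of the quotient is the class of an element of the free algebra, so the induction
  principle descends.
\<close>

lemma quad_alg_induct [consumes 1, case_names one add smult gen]:
  fixes P
  defines "F \<equiv> quad_alg K a b c d"
  assumes u: "u \<in> carrier F"
    and one: "P \<one>\<^bsub>F\<^esub>"
    and add: "\<And>u v. \<lbrakk>u \<in> carrier F; v \<in> carrier F; P u; P v\<rbrakk> \<Longrightarrow> P (u \<oplus>\<^bsub>F\<^esub> v)"
    and smult: "\<And>k u. \<lbrakk>k \<in> carrier K; u \<in> carrier F; P u\<rbrakk> \<Longrightarrow> P (k \<odot>\<^bsub>F\<^esub> u)"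
    and gen: "\<And>v u. \<lbrakk>u \<in> carrier F; P u\<rbrakk> \<Longrightarrow> P (quad_gen K a b c d v \<otimes>\<^bsub>F\<^esub> u)"
  shows "P u"
proof -
  obtain p where p: "p \<in> carrier Free" "u = Rel +>\<^bsub>Free\<^esub> p"
    using u by (auto simp: F_def quad_alg_def quot_alg_simps)
  have car: "Rel +>\<^bsub>Free\<^esub> q \<in> carrier F" if "q \<in> carrier Free" for q
    using that by (simp add: F_def quad_alg_def quot_alg_simps)
  from p(1) have "P (Rel +>\<^bsub>Free\<^esub> p)"
  proof (induction rule: free_alg_induct)
    case one
    then show ?case using \<open>P \<one>\<^bsub>F\<^esub>\<close> by (simp add: F_def quad_alg_def quot_alg_simps)
  next
    case (add p q)
    then show ?case
      using assms(4)[OF car car, of p q] Free.quot_alg_coset(2)[OF ideal_Rel, of p q]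
      by (simp add: F_def quad_alg_def)
  next
    case (smult k p)
    then show ?case
      using assms(5)[OF _ car, of k p] Free.quot_alg_smult[OF ideal_Rel, of k p]
      by (simp add: F_def quad_alg_def)
  next
    case (gen v p)
    then show ?case
      using assms(6)[OF car, of p v] Free.quot_alg_coset(1)[OF ideal_Rel free_gen_closed, of p v]
      by (simp add: F_def quad_alg_def quad_gen_def)
  qed
  then show ?thesis by (simp add: p)
qed

text \<open>
  Operators on a module that satisfy the two relations give a map out of the presented algebra.
  Such operators first give a map \<open>f\<close> out of the free algebra; its kernel is a left ideal, but
  the relations generate a two-sided ideal. The kernel is therefore replaced by the set \<open>J\<close> of
  all \<open>p\<close> with \<open>f (p r) = 0\<close> for every \<open>r\<close>, which is two-sided and contains the relations
  because these hold as equations between operators on the whole image of \<open>f\<close>.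
\<close>

theorem quad_alg_lift_module:
  defines "F \<equiv> quad_alg K a b c d"
  assumes V: "module K V" and \<xi>: "\<xi> \<in> carrier V"
    and T: "\<And>v. T v \<in> module_hom K V V"
    and Tx: "\<And>\<zeta>. \<zeta> \<in> carrier V \<Longrightarrow>
      T Letter_x (T Letter_x \<zeta>) \<oplus>\<^bsub>V\<^esub> a \<odot>\<^bsub>V\<^esub> T Letter_x \<zeta> \<oplus>\<^bsub>V\<^esub> b \<odot>\<^bsub>V\<^esub> \<zeta> = \<zero>\<^bsub>V\<^esub>"
    and Ty: "\<And>\<zeta>. \<zeta> \<in> carrier V \<Longrightarrow>
      T Letter_y (T Letter_y \<zeta>) \<oplus>\<^bsub>V\<^esub> c \<odot>\<^bsub>V\<^esub> T Letter_y \<zeta> \<oplus>\<^bsub>V\<^esub> d \<odot>\<^bsub>V\<^esub> \<zeta> = \<zero>\<^bsub>V\<^esub>"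
  shows "\<exists>\<Psi>\<in>module_hom K F V. \<Psi> \<one>\<^bsub>F\<^esub> = \<xi> \<and>
    (\<forall>v. \<forall>u\<in>carrier F. \<Psi> (quad_gen K a b c d v \<otimes>\<^bsub>F\<^esub> u) = T v (\<Psi> u))"
proof -
  interpret V: module K V by fact
  obtain f where f: "f \<in> module_hom K Free V" "f \<one>\<^bsub>Free\<^esub> = \<xi>"
    and f_gen: "\<And>v p. p \<in> carrier Free \<Longrightarrow> f (free_gen K v \<otimes>\<^bsub>Free\<^esub> p) = T v (f p)"
    using free_alg_lift_module[where L = T, OF V \<xi> T] by blast
  interpret f: mod_hom K Free V f
    using f(1) V Free.module_axioms by (simp add: mod_hom_def mod_hom_axioms_def)
  interpret T: mod_hom K V V "T v" for v
    using T V by (simp add: mod_hom_def mod_hom_axioms_def)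
  interpret Rel: ideal Rel Free by (rule ideal_Rel)

  have f_left: "f (q \<otimes>\<^bsub>Free\<^esub> u) = \<zero>\<^bsub>V\<^esub>"
    if "q \<in> carrier Free" "u \<in> carrier Free" "f u = \<zero>\<^bsub>V\<^esub>" for q u
    using that(1)
  proof (induction rule: free_alg_induct)
    case (gen v p)
    then show ?case using that free_gen_closed[of v] by (simp add: Free.A.m_assoc f_gen)
  qed (use that in \<open>simp_all add: Free.A.l_distr Free.smult_mult_left\<close>)

  define J where "J = {p \<in> carrier Free. \<forall>r\<in>carrier Free. f (p \<otimes>\<^bsub>Free\<^esub> r) = \<zero>\<^bsub>V\<^esub>}"
  have J: "ideal J Free"
  proof (rule idealI[OF Free.A.ring_axioms])
    show "subgroup J (add_monoid Free)"
      by (rule Free.M.add.subgroupI)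
        (auto simp: J_def Free.A.l_distr Free.A.l_minus simp flip: a_inv_def intro!: exI[of _ "\<zero>\<^bsub>Free\<^esub>"])
  qed (auto simp: J_def Free.A.m_assoc f_left)
  have rel_in_J: "quad_rel K v k l \<in> J"
    if kl: "k \<in> carrier K" "l \<in> carrier K"
      and T_rel: "\<And>\<zeta>. \<zeta> \<in> carrier V \<Longrightarrow> T v (T v \<zeta>) \<oplus>\<^bsub>V\<^esub> k \<odot>\<^bsub>V\<^esub> T v \<zeta> \<oplus>\<^bsub>V\<^esub> l \<odot>\<^bsub>V\<^esub> \<zeta> = \<zero>\<^bsub>V\<^esub>"
    for v k l
  proof -
    have "f (quad_rel K v k l \<otimes>\<^bsub>Free\<^esub> r) = \<zero>\<^bsub>V\<^esub>" if r: "r \<in> carrier Free" for r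
    proof -
      have "quad_rel K v k l \<otimes>\<^bsub>Free\<^esub> r = free_gen K v \<otimes>\<^bsub>Free\<^esub> (free_gen K v \<otimes>\<^bsub>Free\<^esub> r)
          \<oplus>\<^bsub>Free\<^esub> k \<odot>\<^bsub>Free\<^esub> (free_gen K v \<otimes>\<^bsub>Free\<^esub> r) \<oplus>\<^bsub>Free\<^esub> l \<odot>\<^bsub>Free\<^esub> r"
        using r kl free_gen_closed[of v]
        by (simp add: quad_rel_def Let_def Free.A.l_distr Free.A.m_assoc Free.smult_mult_left)
      then show ?thesis
        using r kl free_gen_closed[of v] T_rel[of "f r"] by (simp add: f_gen)
    qed
    then show ?thesis using kl by (simp add: J_def quad_rel_closed)
  qed
  have "Rel \<subseteq> J"
    unfolding quad_ideal_def using rel_in_J Tx Ty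
    by (intro Free.A.genideal_minimal[OF J]) auto
  then have f_I: "f p = \<zero>\<^bsub>V\<^esub>" if "p \<in> Rel" for p
    using that Rel.Icarr[OF that] unfolding J_def by force

  \<comment> \<open>As \<open>f\<close> vanishes on \<open>Rel\<close>, any representative of the coset gives the same value.\<close>
  define \<Psi> where "\<Psi> C = f (SOME p. p \<in> carrier Free \<and> C = Rel +>\<^bsub>Free\<^esub> p)" for C
  have \<Psi>: "\<Psi> (Rel +>\<^bsub>Free\<^esub> p) = f p" if p: "p \<in> carrier Free" for p
  proof -
    define q where "q = (SOME q. q \<in> carrier Free \<and> Rel +>\<^bsub>Free\<^esub> p = Rel +>\<^bsub>Free\<^esub> q)"
    have q: "q \<in> carrier Free \<and> Rel +>\<^bsub>Free\<^esub> p = Rel +>\<^bsub>Free\<^esub> q"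
      unfolding q_def by (rule someI[of _ p]) (simp add: p)
    then have "q \<in> Rel +>\<^bsub>Free\<^esub> p" using Rel.a_rcos_self[of q] by simp
    then obtain i where i: "i \<in> Rel" "q = i \<oplus>\<^bsub>Free\<^esub> p"
      by (auto simp: a_r_coset_def')
    then have "f q = f p"
      using p Rel.Icarr[OF i(1)] by (simp add: f_I)
    then show ?thesis by (simp add: \<Psi>_def q_def)
  qed
  have carF: "carrier F = (\<lambda>p. Rel +>\<^bsub>Free\<^esub> p) ` carrier Free"
    by (simp add: F_def quad_alg_def quot_alg_simps)
  have "\<Psi> \<in> module_hom K F V"
    unfolding module_hom_def
    by (auto simp: carF \<Psi>) (auto simp: F_def quad_alg_def \<Psi>
        Free.quot_alg_coset[OF ideal_Rel] Free.quot_alg_smult[OF ideal_Rel])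
  moreover have "\<Psi> \<one>\<^bsub>F\<^esub> = \<xi>"
    by (simp add: F_def quad_alg_def quot_alg_simps \<Psi> f)
  moreover have "\<Psi> (quad_gen K a b c d v \<otimes>\<^bsub>F\<^esub> u) = T v (\<Psi> u)" if "u \<in> carrier F" for v u
    using that unfolding carF
    by (auto simp: F_def quad_alg_def quad_gen_def \<Psi> f_gen free_gen_closed
      Free.quot_alg_coset[OF ideal_Rel])
  ultimately show ?thesis by blast
qed

end

section \<open>Computations with two quadratic generators\<close>

text \<open>
  The coefficients are allowed to be central elements of the algebra, so that scalar
  multiplication does not occur in the noncommutative computations and every expression is a sum
  of words in \<open>x\<close>, \<open>y\<close> and central elements. The assumption \<open>generated\<close> says that \<open>x\<close> and \<open>y\<close>
  generate the algebra.
\<close>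

locale quadratic_generators = unital_algebra K A for K and A (structure) +
  fixes x y \<alpha> \<beta> \<gamma> \<delta>
  assumes xy [simp]: "x \<in> carrier A" "y \<in> carrier A"
    and coeffs_central [simp]: "\<alpha> \<in> carrier (centre A)" "\<beta> \<in> carrier (centre A)"
      "\<gamma> \<in> carrier (centre A)" "\<delta> \<in> carrier (centre A)"
    and x_sq: "x \<otimes> x = \<ominus> (\<alpha> \<otimes> x) \<oplus> \<ominus> \<beta>"
    and y_sq: "y \<otimes> y = \<ominus> (\<gamma> \<otimes> y) \<oplus> \<ominus> \<delta>"
    and generated: "\<lbrakk>u \<in> carrier A; P \<one>;
        \<And>u v. \<lbrakk>u \<in> carrier A; v \<in> carrier A; P u; P v\<rbrakk> \<Longrightarrow> P (u \<oplus> v);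
        \<And>k u. \<lbrakk>k \<in> carrier K; u \<in> carrier A; P u\<rbrakk> \<Longrightarrow> P (k \<odot> u);
        \<And>u. \<lbrakk>u \<in> carrier A; P u\<rbrakk> \<Longrightarrow> P (x \<otimes> u);
        \<And>u. \<lbrakk>u \<in> carrier A; P u\<rbrakk> \<Longrightarrow> P (y \<otimes> u)\<rbrakk> \<Longrightarrow> P u"
begin

definition "\<tau> = x \<otimes> y \<oplus> y \<otimes> x \<oplus> \<gamma> \<otimes> x \<oplus> \<alpha> \<otimes> y"

lemma gen_sq_left:
  assumes "u \<in> carrier A"
  shows "x \<otimes> (x \<otimes> u) = \<ominus> (\<alpha> \<otimes> (x \<otimes> u)) \<oplus> \<ominus> (\<beta> \<otimes> u)"
    and "y \<otimes> (y \<otimes> u) = \<ominus> (\<gamma> \<otimes> (y \<otimes> u)) \<oplus> \<ominus> (\<delta> \<otimes> u)"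
  using assms coeffs_central[THEN centre_closed]
  by (simp_all add: A.l_distr A.l_minus x_sq y_sq flip: A.m_assoc)

lemma coeffs_closed [simp]: "\<alpha> \<in> carrier A" "\<beta> \<in> carrier A" "\<gamma> \<in> carrier A" "\<delta> \<in> carrier A"
  by (simp_all add: centre_closed)

lemma \<tau>_closed [simp]: "\<tau> \<in> carrier A"
  by (simp add: \<tau>_def)

lemmas ring_norm = A.l_distr A.r_distr A.m_assoc A.l_minus A.r_minus M.minus_add M.minus_minus

lemma central_to_left:
  assumes "z \<in> carrier (centre A)"
  shows "x \<otimes> z = z \<otimes> x" "y \<otimes> z = z \<otimes> y"
    and "u \<in> carrier A \<Longrightarrow> x \<otimes> (z \<otimes> u) = z \<otimes> (x \<otimes> u)"
    and "u \<in> carrier A \<Longrightarrow> y \<otimes> (z \<otimes> u) = z \<otimes> (y \<otimes> u)"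
  using assms centre_left_commute[of z x u] centre_left_commute[of z y u]
  by (simp_all add: centre_commute)

lemma \<tau>_commute:
  "x \<otimes> \<tau> = \<tau> \<otimes> x" "y \<otimes> \<tau> = \<tau> \<otimes> y"
  unfolding \<tau>_def
  by (simp_all add: ring_norm x_sq y_sq gen_sq_left central_to_left)
    (use xy coeffs_closed in algebra)+

lemmas generated_induct = generated [consumes 1, case_names one add smult x y]

lemma centreI_generators:
  assumes z: "z \<in> carrier A" and zx: "x \<otimes> z = z \<otimes> x" and zy: "y \<otimes> z = z \<otimes> y"
  shows "z \<in> carrier (centre A)"
proof (rule mem_centreI[OF z])
  fix u assume "u \<in> carrier A"
  then show "z \<otimes> u = u \<otimes> z"
  proof (induction rule: generated_induct)
    fix u assume u: "u \<in> carrier A" "z \<otimes> u = u \<otimes> z"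
    show "z \<otimes> (x \<otimes> u) = x \<otimes> u \<otimes> z" "z \<otimes> (y \<otimes> u) = y \<otimes> u \<otimes> z"
      using u z zx zy by (metis A.m_assoc xy)+
  qed (use z in \<open>simp_all add: A.l_distr A.r_distr smult_mult_left smult_mult_right\<close>)
qed

lemma \<tau>_central [simp]: "\<tau> \<in> carrier (centre A)"
  by (rule centreI_generators) (simp_all add: \<tau>_commute)

text \<open>
  Read from left to right, this rule moves \<open>x\<close> in front of \<open>y\<close>. Together with the two quadratic
  relations it rewrites every word to a combination of \<open>1, x, y, x y\<close> with central coefficients.
\<close>

lemma y_x: "y \<otimes> x = \<tau> \<oplus> \<ominus> (x \<otimes> y) \<oplus> \<ominus> (\<gamma> \<otimes> x) \<oplus> \<ominus> (\<alpha> \<otimes> y)"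
  unfolding \<tau>_def using xy coeffs_closed by algebra

lemma y_x_left:
  assumes "u \<in> carrier A"
  shows "y \<otimes> (x \<otimes> u)
    = \<tau> \<otimes> u \<oplus> \<ominus> (x \<otimes> (y \<otimes> u)) \<oplus> \<ominus> (\<gamma> \<otimes> (x \<otimes> u)) \<oplus> \<ominus> (\<alpha> \<otimes> (y \<otimes> u))"
  using assms by (simp add: A.l_distr A.l_minus y_x A.m_assoc flip: A.m_assoc[of y x u])

lemmas rewrite_words = x_sq y_sq gen_sq_left y_x y_x_left

text \<open>
  These equations order the central factors \<open>\<alpha>, \<beta>, \<gamma>, \<delta>, \<tau>\<close>, so that equal monomials become
  syntactically equal. Every factor is moved to the left of those that come later in this list.
\<close>

lemma coeff_swap:
  "\<tau> \<otimes> \<alpha> = \<alpha> \<otimes> \<tau>" "\<tau> \<otimes> \<beta> = \<beta> \<otimes> \<tau>" "\<tau> \<otimes> \<gamma> = \<gamma> \<otimes> \<tau>" "\<tau> \<otimes> \<delta> = \<delta> \<otimes> \<tau>"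
  "\<delta> \<otimes> \<alpha> = \<alpha> \<otimes> \<delta>" "\<delta> \<otimes> \<beta> = \<beta> \<otimes> \<delta>" "\<delta> \<otimes> \<gamma> = \<gamma> \<otimes> \<delta>"
  "\<gamma> \<otimes> \<alpha> = \<alpha> \<otimes> \<gamma>" "\<gamma> \<otimes> \<beta> = \<beta> \<otimes> \<gamma>" "\<beta> \<otimes> \<alpha> = \<alpha> \<otimes> \<beta>"
  "u \<in> carrier A \<Longrightarrow> \<tau> \<otimes> (\<alpha> \<otimes> u) = \<alpha> \<otimes> (\<tau> \<otimes> u)"
  "u \<in> carrier A \<Longrightarrow> \<tau> \<otimes> (\<beta> \<otimes> u) = \<beta> \<otimes> (\<tau> \<otimes> u)"
  "u \<in> carrier A \<Longrightarrow> \<tau> \<otimes> (\<gamma> \<otimes> u) = \<gamma> \<otimes> (\<tau> \<otimes> u)"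
  "u \<in> carrier A \<Longrightarrow> \<tau> \<otimes> (\<delta> \<otimes> u) = \<delta> \<otimes> (\<tau> \<otimes> u)"
  "u \<in> carrier A \<Longrightarrow> \<delta> \<otimes> (\<alpha> \<otimes> u) = \<alpha> \<otimes> (\<delta> \<otimes> u)"
  "u \<in> carrier A \<Longrightarrow> \<delta> \<otimes> (\<beta> \<otimes> u) = \<beta> \<otimes> (\<delta> \<otimes> u)"
  "u \<in> carrier A \<Longrightarrow> \<delta> \<otimes> (\<gamma> \<otimes> u) = \<gamma> \<otimes> (\<delta> \<otimes> u)"
  "u \<in> carrier A \<Longrightarrow> \<gamma> \<otimes> (\<alpha> \<otimes> u) = \<alpha> \<otimes> (\<gamma> \<otimes> u)"
  "u \<in> carrier A \<Longrightarrow> \<gamma> \<otimes> (\<beta> \<otimes> u) = \<beta> \<otimes> (\<gamma> \<otimes> u)"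
  "u \<in> carrier A \<Longrightarrow> \<beta> \<otimes> (\<alpha> \<otimes> u) = \<alpha> \<otimes> (\<beta> \<otimes> u)"
  by (rule centre_commute centre_left_commute; simp)+

definition "w = x \<otimes> y \<oplus> \<ominus> (y \<otimes> x)"

definition comb where "comb p q r s = p \<oplus> q \<otimes> x \<oplus> r \<otimes> y \<oplus> s \<otimes> (x \<otimes> y)"

context
  fixes p q r s
  assumes pqrs [simp]: "p \<in> carrier (centre A)" "q \<in> carrier (centre A)"
    "r \<in> carrier (centre A)" "s \<in> carrier (centre A)"
begin

lemma pqrs_closed [simp]: "p \<in> carrier A" "q \<in> carrier A" "r \<in> carrier A" "s \<in> carrier A"
  by (simp_all add: centre_closed)

text \<open>
  This lemma and the next describe left multiplication by the generators on coefficients. They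
  are also the source of the operators that show independence below.
\<close>

lemma x_comb:
  "x \<otimes> comb p q r s
    = comb (\<ominus> (q \<otimes> \<beta>)) (p \<oplus> \<ominus> (q \<otimes> \<alpha>)) (\<ominus> (s \<otimes> \<beta>)) (r \<oplus> \<ominus> (s \<otimes> \<alpha>))"
  unfolding comb_def
  by (simp add: ring_norm rewrite_words central_to_left)
    (use xy coeffs_closed \<tau>_closed pqrs_closed in algebra)

lemma y_comb:
  "y \<otimes> comb p q r s
    = comb (q \<otimes> \<tau> \<oplus> \<ominus> (r \<otimes> \<delta>) \<oplus> s \<otimes> (\<alpha> \<otimes> \<delta>))
        (\<ominus> (q \<otimes> \<gamma>) \<oplus> s \<otimes> \<delta>)
        (p \<oplus> \<ominus> (q \<otimes> \<alpha>) \<oplus> \<ominus> (r \<otimes> \<gamma>) \<oplus> s \<otimes> \<tau> \<oplus> s \<otimes> (\<alpha> \<otimes> \<gamma>))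
        (\<ominus> q)"
  unfolding comb_def
  by (simp add: ring_norm rewrite_words central_to_left M.a_ac)
    (use xy coeffs_closed \<tau>_closed pqrs_closed in algebra)

text \<open>
  As \<open>x\<close> commutes with \<open>1\<close> and \<open>x\<close>, only \<open>r y\<close> and \<open>s x y\<close> contribute, and
  \<open>x (x y) - (x y) x = x w\<close>.
\<close>

lemma x_commutator: "x \<otimes> comb p q r s \<oplus> \<ominus> (comb p q r s \<otimes> x) = (r \<oplus> s \<otimes> x) \<otimes> w"
  unfolding comb_def w_def
  by (simp add: ring_norm central_to_left)
    (use xy coeffs_closed \<tau>_closed pqrs_closed in algebra)

end

lemma y_commutator:
  assumes "p \<in> carrier (centre A)" "q \<in> carrier (centre A)"
  shows "comb p q \<zero> \<zero> \<otimes> y \<oplus> \<ominus> (y \<otimes> comb p q \<zero> \<zero>) = q \<otimes> w"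
  using assms assms[THEN centre_closed] unfolding comb_def w_def
  by (simp add: ring_norm central_to_left)
    (use assms[THEN centre_closed] xy in algebra)

lemma x_y_x: "x \<otimes> (y \<otimes> x) = \<tau> \<otimes> x \<oplus> \<beta> \<otimes> y \<oplus> \<alpha> \<otimes> (\<gamma> \<otimes> x) \<oplus> \<beta> \<otimes> \<gamma>"
  by (simp add: ring_norm rewrite_words central_to_left coeff_swap M.a_ac)
    (use xy coeffs_closed \<tau>_closed in algebra)

lemma y_x_y: "y \<otimes> (x \<otimes> y) = \<tau> \<otimes> y \<oplus> \<delta> \<otimes> x \<oplus> \<alpha> \<otimes> (\<gamma> \<otimes> y) \<oplus> \<alpha> \<otimes> \<delta>"
  by (simp add: ring_norm rewrite_words central_to_left coeff_swap M.a_ac)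
    (use xy coeffs_closed \<tau>_closed in algebra)

text \<open>
  With \<open>m = x y\<close> and \<open>n = y x\<close> one has \<open>(m - n)\<^sup>2 = (m + n)\<^sup>2 - 2 (m n + n m)\<close>. This helps because
  \<open>m + n = \<tau> - \<gamma> x - \<alpha> y\<close> is linear in the generators, while \<open>m n = x y\<^sup>2 x\<close> and \<open>n m = y x\<^sup>2 y\<close>
  can be shortened by the quadratic relations.
\<close>

lemma w_squared_expand:
  defines "m \<equiv> x \<otimes> y" and "n \<equiv> y \<otimes> x"
  shows "w \<otimes> w = (m \<oplus> n) \<otimes> (m \<oplus> n) \<oplus> \<ominus> (m \<otimes> n \<oplus> n \<otimes> m) \<oplus> \<ominus> (m \<otimes> n \<oplus> n \<otimes> m)"
proof -
  have "m \<in> carrier A" "n \<in> carrier A" by (simp_all add: m_def n_def)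
  then show ?thesis
    unfolding w_def m_def[symmetric] n_def[symmetric] by algebra
qed

text \<open>
  The terms that involve \<open>x\<close> or \<open>y\<close>. They are subtracted twice in \<open>(m + n)\<^sup>2\<close> and once in
  \<open>m n + n m\<close>, so they cancel in \<open>w\<^sup>2\<close>.
\<close>

definition "cross = \<gamma> \<otimes> (\<tau> \<otimes> x) \<oplus> \<alpha> \<otimes> (\<tau> \<otimes> y) \<oplus> \<alpha> \<otimes> (\<gamma> \<otimes> (\<gamma> \<otimes> x)) \<oplus> \<alpha> \<otimes> (\<alpha> \<otimes> (\<gamma> \<otimes> y))"
definition "squares = \<beta> \<otimes> (\<gamma> \<otimes> \<gamma>) \<oplus> \<alpha> \<otimes> (\<alpha> \<otimes> \<delta>)"

lemma mixed_products: "(x \<otimes> y) \<otimes> (y \<otimes> x) \<oplus> (y \<otimes> x) \<otimes> (x \<otimes> y) = \<ominus> cross \<oplus> \<ominus> squares \<oplus> (\<beta> \<otimes> \<delta> \<oplus> \<beta> \<otimes> \<delta>)"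
proof -
  have 1: "(x \<otimes> y) \<otimes> (y \<otimes> x)
      = \<ominus> (\<gamma> \<otimes> (\<tau> \<otimes> x) \<oplus> \<beta> \<otimes> (\<gamma> \<otimes> y) \<oplus> \<alpha> \<otimes> (\<gamma> \<otimes> (\<gamma> \<otimes> x)) \<oplus> \<beta> \<otimes> (\<gamma> \<otimes> \<gamma>))
        \<oplus> \<alpha> \<otimes> (\<delta> \<otimes> x) \<oplus> \<beta> \<otimes> \<delta>"
  proof -
    have "(x \<otimes> y) \<otimes> (y \<otimes> x) = \<ominus> (\<gamma> \<otimes> (x \<otimes> (y \<otimes> x))) \<oplus> \<ominus> (\<delta> \<otimes> (x \<otimes> x))"
      by (simp add: A.m_assoc gen_sq_left A.r_distr A.r_minus central_to_left)
    then show ?thesis unfolding x_y_x x_sq by (simp add: ring_norm coeff_swap M.a_assoc)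
  qed
  have 2: "(y \<otimes> x) \<otimes> (x \<otimes> y)
      = \<ominus> (\<alpha> \<otimes> (\<tau> \<otimes> y) \<oplus> \<alpha> \<otimes> (\<delta> \<otimes> x) \<oplus> \<alpha> \<otimes> (\<alpha> \<otimes> (\<gamma> \<otimes> y)) \<oplus> \<alpha> \<otimes> (\<alpha> \<otimes> \<delta>))
        \<oplus> \<beta> \<otimes> (\<gamma> \<otimes> y) \<oplus> \<beta> \<otimes> \<delta>"
  proof -
    have "(y \<otimes> x) \<otimes> (x \<otimes> y) = \<ominus> (\<alpha> \<otimes> (y \<otimes> (x \<otimes> y))) \<oplus> \<ominus> (\<beta> \<otimes> (y \<otimes> y))"
      by (simp add: A.m_assoc gen_sq_left A.r_distr A.r_minus central_to_left)
    then show ?thesis unfolding y_x_y y_sq by (simp add: ring_norm coeff_swap M.a_assoc)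
  qed
  have cancel: "\<ominus> (a1 \<oplus> a2 \<oplus> a3 \<oplus> a4) \<oplus> a5 \<oplus> a6 \<oplus> (\<ominus> (a7 \<oplus> a5 \<oplus> a8 \<oplus> a9) \<oplus> a2 \<oplus> a6)
      = \<ominus> (a1 \<oplus> a7 \<oplus> a3 \<oplus> a8) \<oplus> \<ominus> (a4 \<oplus> a9) \<oplus> (a6 \<oplus> a6)"
    if "a1 \<in> carrier A" "a2 \<in> carrier A" "a3 \<in> carrier A" "a4 \<in> carrier A" "a5 \<in> carrier A"
      "a6 \<in> carrier A" "a7 \<in> carrier A" "a8 \<in> carrier A" "a9 \<in> carrier A"
    for a1 a2 a3 a4 a5 a6 a7 a8 a9
    using that by algebra
  show ?thesis unfolding 1 2 cross_def squares_def by (rule cancel) simp_all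
qed

lemma square_of_sum: "(x \<otimes> y \<oplus> y \<otimes> x) \<otimes> (x \<otimes> y \<oplus> y \<otimes> x)
    = \<tau> \<otimes> \<tau> \<oplus> \<alpha> \<otimes> (\<gamma> \<otimes> \<tau>) \<oplus> \<ominus> cross \<oplus> \<ominus> cross \<oplus> \<ominus> squares"
proof -
  define P where "P = \<gamma> \<otimes> x \<oplus> \<alpha> \<otimes> y"
  define lin1 where "lin1 = \<gamma> \<otimes> (\<tau> \<otimes> x) \<oplus> \<alpha> \<otimes> (\<tau> \<otimes> y)"
  define lin2 where "lin2 = \<alpha> \<otimes> (\<gamma> \<otimes> (\<gamma> \<otimes> x)) \<oplus> \<alpha> \<otimes> (\<alpha> \<otimes> (\<gamma> \<otimes> y))"
  have cl: "P \<in> carrier A" "lin1 \<in> carrier A" "lin2 \<in> carrier A" "squares \<in> carrier A"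
    by (simp_all add: P_def lin1_def lin2_def squares_def)
  have cross: "cross = lin1 \<oplus> lin2" by (simp add: cross_def lin1_def lin2_def M.a_assoc)
  have 1: "x \<otimes> y \<oplus> y \<otimes> x = \<tau> \<oplus> \<ominus> P"
    unfolding \<tau>_def P_def using xy coeffs_closed by algebra
  have 2: "\<tau> \<otimes> P = lin1" "P \<otimes> \<tau> = lin1"
    by (simp_all add: P_def lin1_def ring_norm coeff_swap central_to_left)
  have 3: "P \<otimes> P = \<alpha> \<otimes> (\<gamma> \<otimes> (x \<otimes> y \<oplus> y \<otimes> x)) \<oplus> \<ominus> lin2 \<oplus> \<ominus> squares"
    by (simp add: P_def lin2_def squares_def ring_norm x_sq y_sq coeff_swap central_to_left)
      (use xy coeffs_closed in algebra)
  have 4: "\<alpha> \<otimes> (\<gamma> \<otimes> (x \<otimes> y \<oplus> y \<otimes> x)) = \<alpha> \<otimes> (\<gamma> \<otimes> \<tau>) \<oplus> \<ominus> lin2"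
    unfolding 1 by (simp add: P_def lin2_def ring_norm coeff_swap)
  have "(\<tau> \<oplus> \<ominus> P) \<otimes> (\<tau> \<oplus> \<ominus> P) = \<tau> \<otimes> \<tau> \<oplus> \<ominus> (\<tau> \<otimes> P) \<oplus> \<ominus> (P \<otimes> \<tau>) \<oplus> P \<otimes> P"
    using cl \<tau>_closed by algebra
  also have "\<dots> = \<tau> \<otimes> \<tau> \<oplus> \<ominus> lin1 \<oplus> \<ominus> lin1 \<oplus> (\<alpha> \<otimes> (\<gamma> \<otimes> \<tau>) \<oplus> \<ominus> lin2 \<oplus> \<ominus> lin2 \<oplus> \<ominus> squares)"
    unfolding 2 3 4 ..
  also have "\<dots> = \<tau> \<otimes> \<tau> \<oplus> \<alpha> \<otimes> (\<gamma> \<otimes> \<tau>) \<oplus> \<ominus> cross \<oplus> \<ominus> cross \<oplus> \<ominus> squares"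
    unfolding cross using cl \<tau>_closed coeffs_closed by algebra
  finally show ?thesis unfolding 1 .
qed

lemma cross_squares_closed: "cross \<in> carrier A" "squares \<in> carrier A"
  by (simp_all add: cross_def squares_def)

lemma w_squared: "w \<otimes> w = \<tau> \<otimes> \<tau> \<oplus> \<alpha> \<otimes> (\<gamma> \<otimes> \<tau>) \<oplus> squares
   \<oplus> \<ominus> (\<beta> \<otimes> \<delta> \<oplus> \<beta> \<otimes> \<delta> \<oplus> \<beta> \<otimes> \<delta> \<oplus> \<beta> \<otimes> \<delta>)"
  unfolding w_squared_expand mixed_products square_of_sum
  using cross_squares_closed coeffs_closed \<tau>_closed by algebra

end

section \<open>Unique coefficients over the polynomials in one central element\<close>

text \<open>
  Multiplication by the indeterminate takes the place of induction on the degree: it produces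
  all monomials from the constants.
\<close>

lemma (in UP_ring) UP_induct [consumes 1, case_names const add X]:
  assumes p: "p \<in> carrier P"
    and const: "\<And>k. k \<in> carrier R \<Longrightarrow> Q (monom P k 0)"
    and add: "\<And>p q. \<lbrakk>p \<in> carrier P; q \<in> carrier P; Q p; Q q\<rbrakk> \<Longrightarrow> Q (p \<oplus>\<^bsub>P\<^esub> q)"
    and X: "\<And>p. \<lbrakk>p \<in> carrier P; Q p\<rbrakk> \<Longrightarrow> Q (monom P \<one> 1 \<otimes>\<^bsub>P\<^esub> p)"
  shows "Q p"
proof -
  have monom: "Q (monom P k n)" if k: "k \<in> carrier R" for k n
  proof (induction n)
    case 0
    show ?case using const[OF k] .
  next
    case (Suc n)
    have "monom P k (Suc n) = monom P \<one> 1 \<otimes>\<^bsub>P\<^esub> monom P k n"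
      using k monom_mult[OF R.one_closed k, of 1 n] by simp
    then show ?case using X[OF monom_closed[OF k] Suc.IH] by simp
  qed
  have "Q (\<Oplus>\<^bsub>P\<^esub>i\<in>S. monom P (coeff P p i) i)" if "finite S" for S
    using that
  proof (induction S)
    case empty
    show ?case using const[OF R.zero_closed] by simp
  next
    case (insert i S)
    then show ?case using p monom add by (simp add: Pi_def)
  qed
  then show ?thesis using up_repr[OF p] by (metis finite_atMost)
qed

text \<open>
  The next three lemmas are the componentwise form of three equations between the operators
  \<open>act\<close> below: the two quadratic relations, and the equation that expresses \<open>\<tau>\<close> by the generators.
  The letters \<open>A, B, C, D\<close> stand for the constant polynomials \<open>a, b, c, d\<close>, and \<open>X\<close> for the
  indeterminate. For \<open>x\<close> two components suffice, because it acts in the same way on \<open>(p, q)\<close> and on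
  \<open>(r, s)\<close>. In each component the monomials are sorted first, which leaves only cancellation.
\<close>

context cring
begin

lemma coordinates_relation_x:
  assumes "p \<in> carrier R" "q \<in> carrier R" "A \<in> carrier R" "B \<in> carrier R"
  shows "\<ominus> ((p \<oplus> \<ominus> (q \<otimes> A)) \<otimes> B) \<oplus> A \<otimes> \<ominus> (q \<otimes> B) \<oplus> B \<otimes> p = \<zero>"
    "\<ominus> (q \<otimes> B) \<oplus> \<ominus> ((p \<oplus> \<ominus> (q \<otimes> A)) \<otimes> A) \<oplus> A \<otimes> (p \<oplus> \<ominus> (q \<otimes> A)) \<oplus> B \<otimes> q = \<zero>"
  using assms by algebra+

lemma coordinates_relation_y:
  assumes "A \<in> carrier R" "C \<in> carrier R" "D \<in> carrier R" "X \<in> carrier R" "p \<in> carrier R"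
    "q \<in> carrier R" "r \<in> carrier R" "s \<in> carrier R"
  shows "(\<ominus> (q \<otimes> C) \<oplus> s \<otimes> D) \<otimes> X \<oplus> \<ominus> ((p \<oplus> \<ominus> (q \<otimes> A) \<oplus> \<ominus> (r \<otimes> C) \<oplus> s \<otimes> X \<oplus> s \<otimes> (A \<otimes> C)) \<otimes> D)
     \<oplus> (\<ominus> q) \<otimes> (A \<otimes> D) \<oplus> C \<otimes> (q \<otimes> X \<oplus> \<ominus> (r \<otimes> D) \<oplus> s \<otimes> (A \<otimes> D)) \<oplus> D \<otimes> p = \<zero>"
    "\<ominus> ((\<ominus> (q \<otimes> C) \<oplus> s \<otimes> D) \<otimes> C) \<oplus> (\<ominus> q) \<otimes> D \<oplus> C \<otimes> (\<ominus> (q \<otimes> C) \<oplus> s \<otimes> D) \<oplus> D \<otimes> q = \<zero>"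
    "(q \<otimes> X \<oplus> \<ominus> (r \<otimes> D) \<oplus> s \<otimes> (A \<otimes> D)) \<oplus> \<ominus> ((\<ominus> (q \<otimes> C) \<oplus> s \<otimes> D) \<otimes> A)
        \<oplus> \<ominus> ((p \<oplus> \<ominus> (q \<otimes> A) \<oplus> \<ominus> (r \<otimes> C) \<oplus> s \<otimes> X \<oplus> s \<otimes> (A \<otimes> C)) \<otimes> C) \<oplus> (\<ominus> q) \<otimes> X
        \<oplus> (\<ominus> q) \<otimes> (A \<otimes> C) \<oplus> C \<otimes> (p \<oplus> \<ominus> (q \<otimes> A) \<oplus> \<ominus> (r \<otimes> C) \<oplus> s \<otimes> X \<oplus> s \<otimes> (A \<otimes> C)) \<oplus> D \<otimes> r
        = \<zero>"
    "\<ominus> (\<ominus> (q \<otimes> C) \<oplus> s \<otimes> D) \<oplus> C \<otimes> (\<ominus> q) \<oplus> D \<otimes> s = \<zero>"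
  using assms
  apply (simp_all only: l_distr r_distr l_minus r_minus minus_add minus_minus m_closed a_closed a_inv_closed)
  apply (simp_all add: m_ac)
  apply (simp_all add: a_ac)
  apply algebra
  apply algebra
  apply algebra
  apply algebra
  done

lemma coordinates_trace:
  assumes "A \<in> carrier R" "B \<in> carrier R" "C \<in> carrier R" "D \<in> carrier R" "X \<in> carrier R"
    "p \<in> carrier R" "q \<in> carrier R" "r \<in> carrier R" "s \<in> carrier R"
  shows "\<ominus> ((\<ominus> (q \<otimes> C) \<oplus> s \<otimes> D) \<otimes> B)
      \<oplus> ((p \<oplus> \<ominus> (q \<otimes> A)) \<otimes> X \<oplus> \<ominus> (\<ominus> (s \<otimes> B) \<otimes> D) \<oplus> (r \<oplus> \<ominus> (s \<otimes> A)) \<otimes> (A \<otimes> D))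
      \<oplus> C \<otimes> \<ominus> (q \<otimes> B) \<oplus> A \<otimes> (q \<otimes> X \<oplus> \<ominus> (r \<otimes> D) \<oplus> s \<otimes> (A \<otimes> D)) = X \<otimes> p"
    "q \<otimes> X \<oplus> \<ominus> (r \<otimes> D) \<oplus> s \<otimes> (A \<otimes> D) \<oplus> \<ominus> ((\<ominus> (q \<otimes> C) \<oplus> s \<otimes> D) \<otimes> A)
        \<oplus> (\<ominus> ((p \<oplus> \<ominus> (q \<otimes> A)) \<otimes> C) \<oplus> (r \<oplus> \<ominus> (s \<otimes> A)) \<otimes> D) \<oplus> C \<otimes> (p \<oplus> \<ominus> (q \<otimes> A))
        \<oplus> A \<otimes> (\<ominus> (q \<otimes> C) \<oplus> s \<otimes> D) = X \<otimes> q"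
    "\<ominus> (\<ominus> q \<otimes> B)
        \<oplus> (\<ominus> (q \<otimes> B) \<oplus> \<ominus> ((p \<oplus> \<ominus> (q \<otimes> A)) \<otimes> A) \<oplus> \<ominus> (\<ominus> (s \<otimes> B) \<otimes> C) \<oplus> (r \<oplus> \<ominus> (s \<otimes> A)) \<otimes> X \<oplus> (r \<oplus> \<ominus> (s \<otimes> A)) \<otimes> (A \<otimes> C))
        \<oplus> C \<otimes> \<ominus> (s \<otimes> B) \<oplus> A \<otimes> (p \<oplus> \<ominus> (q \<otimes> A) \<oplus> \<ominus> (r \<otimes> C) \<oplus> s \<otimes> X \<oplus> s \<otimes> (A \<otimes> C)) = X \<otimes> r"
    "p \<oplus> \<ominus> (q \<otimes> A) \<oplus> \<ominus> (r \<otimes> C) \<oplus> s \<otimes> X \<oplus> s \<otimes> (A \<otimes> C) \<oplus> \<ominus> (\<ominus> q \<otimes> A) \<oplus> \<ominus> (p \<oplus> \<ominus> (q \<otimes> A))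
        \<oplus> C \<otimes> (r \<oplus> \<ominus> (s \<otimes> A)) \<oplus> A \<otimes> \<ominus> q = X \<otimes> s"
  using assms
  apply (simp_all only: l_distr r_distr l_minus r_minus minus_add minus_minus m_closed a_closed a_inv_closed)
  apply (simp_all add: m_ac)
  apply (simp_all add: a_ac)
  apply algebra
  apply algebra
  apply algebra
  apply algebra
  done

end

locale two_quadratics_field = two_quadratics K a b c d + UP_domain K P + field K
  for K (structure) and P and a b c d
begin

abbreviation "F \<equiv> quad_alg K a b c d"
abbreviation "x \<equiv> quad_gen K a b c d Letter_x"
abbreviation "y \<equiv> quad_gen K a b c d Letter_y"

sublocale F: unital_algebra K F
  by (rule quad_alg_unital_algebra)

abbreviation \<iota> where "\<iota> k \<equiv> k \<odot>\<^bsub>F\<^esub> \<one>\<^bsub>F\<^esub>"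

lemma \<iota>_mult: "\<lbrakk>k \<in> carrier K; u \<in> carrier F\<rbrakk> \<Longrightarrow> \<iota> k \<otimes>\<^bsub>F\<^esub> u = k \<odot>\<^bsub>F\<^esub> u"
  by (simp add: F.smult_mult_left)

sublocale G: quadratic_generators K F x y "\<iota> a" "\<iota> b" "\<iota> c" "\<iota> d"
proof unfold_locales
  have sq: "g \<otimes>\<^bsub>F\<^esub> g = \<ominus>\<^bsub>F\<^esub> (\<iota> k \<otimes>\<^bsub>F\<^esub> g) \<oplus>\<^bsub>F\<^esub> \<ominus>\<^bsub>F\<^esub> \<iota> l"
    if "g \<in> carrier F" "k \<in> carrier K" "l \<in> carrier K"
      "g \<otimes>\<^bsub>F\<^esub> g \<oplus>\<^bsub>F\<^esub> k \<odot>\<^bsub>F\<^esub> g \<oplus>\<^bsub>F\<^esub> \<iota> l = \<zero>\<^bsub>F\<^esub>" for g k l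
  proof -
    have "g \<otimes>\<^bsub>F\<^esub> g \<oplus>\<^bsub>F\<^esub> (\<iota> k \<otimes>\<^bsub>F\<^esub> g \<oplus>\<^bsub>F\<^esub> \<iota> l) = \<zero>\<^bsub>F\<^esub>"
      using that by (simp add: \<iota>_mult F.M.a_assoc)
    then have "g \<otimes>\<^bsub>F\<^esub> g = \<ominus>\<^bsub>F\<^esub> (\<iota> k \<otimes>\<^bsub>F\<^esub> g \<oplus>\<^bsub>F\<^esub> \<iota> l)"
      using that by (intro F.M.minus_equality[symmetric]) simp_all
    then show ?thesis using that by (simp add: F.M.minus_add)
  qed
  show "x \<otimes>\<^bsub>F\<^esub> x = \<ominus>\<^bsub>F\<^esub> (\<iota> a \<otimes>\<^bsub>F\<^esub> x) \<oplus>\<^bsub>F\<^esub> \<ominus>\<^bsub>F\<^esub> \<iota> b"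
    by (rule sq) (simp_all add: quad_gen_closed quad_gen_relation)
  show "y \<otimes>\<^bsub>F\<^esub> y = \<ominus>\<^bsub>F\<^esub> (\<iota> c \<otimes>\<^bsub>F\<^esub> y) \<oplus>\<^bsub>F\<^esub> \<ominus>\<^bsub>F\<^esub> \<iota> d"
    by (rule sq) (simp_all add: quad_gen_closed quad_gen_relation)
next
  fix u Q
  assume "u \<in> carrier F" "Q \<one>\<^bsub>F\<^esub>"
    and "\<And>u v. \<lbrakk>u \<in> carrier F; v \<in> carrier F; Q u; Q v\<rbrakk> \<Longrightarrow> Q (u \<oplus>\<^bsub>F\<^esub> v)"
    and "\<And>k u. \<lbrakk>k \<in> carrier K; u \<in> carrier F; Q u\<rbrakk> \<Longrightarrow> Q (k \<odot>\<^bsub>F\<^esub> u)"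
    and xy: "\<And>u. \<lbrakk>u \<in> carrier F; Q u\<rbrakk> \<Longrightarrow> Q (x \<otimes>\<^bsub>F\<^esub> u)"
      "\<And>u. \<lbrakk>u \<in> carrier F; Q u\<rbrakk> \<Longrightarrow> Q (y \<otimes>\<^bsub>F\<^esub> u)"
  then show "Q u"
  proof (induction rule: quad_alg_induct)
    case (gen v u)
    then show ?case using xy by (cases v) auto
  qed auto
qed (simp_all add: quad_gen_closed F.smult_one_in_centre)

sublocale ev: UP_pre_univ_prop K "centre F" \<iota> P
proof -
  interpret C: cring "centre F" by (rule F.centre_cring)
  show "P \<equiv> UP K" by (rule P_def)
  show "UP_pre_univ_prop K (centre F) \<iota>"
    by unfold_locales
      (auto intro!: ring_hom_memI
        simp: F.smult_one_in_centre F.smult_mult_left F.smult_assoc1 F.smult_l_distr)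
qed

text \<open>
  Substitution of \<open>\<tau>\<close> for the indeterminate. The target is the centre, since substitution needs
  a commutative ring.
\<close>

definition \<phi> where "\<phi> = eval K (centre F) \<iota> G.\<tau>"

lemma \<phi>_hom: "\<phi> \<in> ring_hom P (centre F)"
  unfolding \<phi>_def by (rule ev.eval_ring_hom) simp

lemma \<phi>_central [simp]: "p \<in> carrier P \<Longrightarrow> \<phi> p \<in> carrier (centre F)"
  using ring_hom_closed[OF \<phi>_hom] .

lemma \<phi>_closed [simp]: "p \<in> carrier P \<Longrightarrow> \<phi> p \<in> carrier F"
  by (simp add: centre_closed)

lemma \<phi>_add: "\<lbrakk>p \<in> carrier P; q \<in> carrier P\<rbrakk> \<Longrightarrow> \<phi> (p \<oplus>\<^bsub>P\<^esub> q) = \<phi> p \<oplus>\<^bsub>F\<^esub> \<phi> q"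
  using ring_hom_add[OF \<phi>_hom] by simp

lemma \<phi>_mult: "\<lbrakk>p \<in> carrier P; q \<in> carrier P\<rbrakk> \<Longrightarrow> \<phi> (p \<otimes>\<^bsub>P\<^esub> q) = \<phi> p \<otimes>\<^bsub>F\<^esub> \<phi> q"
  using ring_hom_mult[OF \<phi>_hom] by simp

lemma \<phi>_one: "\<phi> \<one>\<^bsub>P\<^esub> = \<one>\<^bsub>F\<^esub>"
  using ring_hom_one[OF \<phi>_hom] by simp

lemma \<phi>_const: "k \<in> carrier K \<Longrightarrow> \<phi> (monom P k 0) = \<iota> k"
  unfolding \<phi>_def by (rule ev.eval_const) simp_all

lemma \<phi>_X: "\<phi> (monom P \<one> 1) = G.\<tau>"
  unfolding \<phi>_def by (rule ev.eval_monom1) simp_all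

lemma \<phi>_zero: "\<phi> \<zero>\<^bsub>P\<^esub> = \<zero>\<^bsub>F\<^esub>"
  using \<phi>_const[OF K.zero_closed] by simp

lemma \<phi>_a_inv: "p \<in> carrier P \<Longrightarrow> \<phi> (\<ominus>\<^bsub>P\<^esub> p) = \<ominus>\<^bsub>F\<^esub> \<phi> p"
  using \<phi>_add[of "\<ominus>\<^bsub>P\<^esub> p" p] by (simp add: \<phi>_zero P.l_neg F.M.minus_equality)

lemma \<phi>_smult: "\<lbrakk>k \<in> carrier K; p \<in> carrier P\<rbrakk> \<Longrightarrow> \<phi> (k \<odot>\<^bsub>P\<^esub> p) = k \<odot>\<^bsub>F\<^esub> \<phi> p"
  by (simp add: \<phi>_mult \<phi>_const \<iota>_mult flip: monom_mult_is_smult)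

abbreviation "pA \<equiv> monom P a 0"
abbreviation "pB \<equiv> monom P b 0"
abbreviation "pC \<equiv> monom P c 0"
abbreviation "pD \<equiv> monom P d 0"
abbreviation "pX \<equiv> monom P \<one> 1"

lemmas \<phi>_simps = \<phi>_add \<phi>_mult \<phi>_one \<phi>_const \<phi>_X \<phi>_X[unfolded One_nat_def] \<phi>_zero \<phi>_a_inv \<phi>_smult

text \<open>
  The coefficients of \<open>x u\<close> and \<open>y u\<close> in terms of those of \<open>u\<close>, taken from \<open>G.x_comb\<close> and
  \<open>G.y_comb\<close> with \<open>\<tau>\<close> replaced by the indeterminate.
\<close>

fun act where
  "act Letter_x (p, q, r, s) =
    (\<ominus>\<^bsub>P\<^esub> (q \<otimes>\<^bsub>P\<^esub> pB), p \<oplus>\<^bsub>P\<^esub> \<ominus>\<^bsub>P\<^esub> (q \<otimes>\<^bsub>P\<^esub> pA),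
     \<ominus>\<^bsub>P\<^esub> (s \<otimes>\<^bsub>P\<^esub> pB), r \<oplus>\<^bsub>P\<^esub> \<ominus>\<^bsub>P\<^esub> (s \<otimes>\<^bsub>P\<^esub> pA))"
| "act Letter_y (p, q, r, s) =
    (q \<otimes>\<^bsub>P\<^esub> pX \<oplus>\<^bsub>P\<^esub> \<ominus>\<^bsub>P\<^esub> (r \<otimes>\<^bsub>P\<^esub> pD) \<oplus>\<^bsub>P\<^esub> s \<otimes>\<^bsub>P\<^esub> (pA \<otimes>\<^bsub>P\<^esub> pD),
     \<ominus>\<^bsub>P\<^esub> (q \<otimes>\<^bsub>P\<^esub> pC) \<oplus>\<^bsub>P\<^esub> s \<otimes>\<^bsub>P\<^esub> pD,
     p \<oplus>\<^bsub>P\<^esub> \<ominus>\<^bsub>P\<^esub> (q \<otimes>\<^bsub>P\<^esub> pA) \<oplus>\<^bsub>P\<^esub> \<ominus>\<^bsub>P\<^esub> (r \<otimes>\<^bsub>P\<^esub> pC) \<oplus>\<^bsub>P\<^esub> s \<otimes>\<^bsub>P\<^esub> pX \<oplus>\<^bsub>P\<^esub> s \<otimes>\<^bsub>P\<^esub> (pA \<otimes>\<^bsub>P\<^esub> pC),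
     \<ominus>\<^bsub>P\<^esub> q)"

definition "V = direct_sum P (direct_sum P (direct_sum P P))"

lemma V_module: "module K V"
  unfolding V_def by (intro direct_sum_is_module algebra.module[OF UP_algebra])

lemma V_simps:
  "carrier V = carrier P \<times> carrier P \<times> carrier P \<times> carrier P"
  "\<zero>\<^bsub>V\<^esub> = (\<zero>\<^bsub>P\<^esub>, \<zero>\<^bsub>P\<^esub>, \<zero>\<^bsub>P\<^esub>, \<zero>\<^bsub>P\<^esub>)"
  "(p, q, r, s) \<oplus>\<^bsub>V\<^esub> (p', q', r', s')
    = (p \<oplus>\<^bsub>P\<^esub> p', q \<oplus>\<^bsub>P\<^esub> q', r \<oplus>\<^bsub>P\<^esub> r', s \<oplus>\<^bsub>P\<^esub> s')"
  "k \<odot>\<^bsub>V\<^esub> (p, q, r, s) = (k \<odot>\<^bsub>P\<^esub> p, k \<odot>\<^bsub>P\<^esub> q, k \<odot>\<^bsub>P\<^esub> r, k \<odot>\<^bsub>P\<^esub> s)"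
  by (simp_all add: V_def direct_sum_def)

lemma act_hom: "act v \<in> module_hom K V V"
proof -
  have closed: "act v \<zeta> \<in> carrier V" if "\<zeta> \<in> carrier V" for \<zeta>
    using that by (cases v; cases \<zeta>) (simp_all add: V_simps)
  have add: "act v (\<zeta> \<oplus>\<^bsub>V\<^esub> \<eta>) = act v \<zeta> \<oplus>\<^bsub>V\<^esub> act v \<eta>"
    if "\<zeta> \<in> carrier V" "\<eta> \<in> carrier V" for \<zeta> \<eta>
  proof -
    obtain p q r s p' q' r' s' where *: "\<zeta> = (p, q, r, s)" "\<eta> = (p', q', r', s')"
      by (metis surj_pair)
    then have "p \<in> carrier P" "q \<in> carrier P" "r \<in> carrier P" "s \<in> carrier P"
      "p' \<in> carrier P" "q' \<in> carrier P" "r' \<in> carrier P" "s' \<in> carrier P"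
      using that by (simp_all add: V_simps)
    then show ?thesis
      by (cases v) (simp_all add: * V_simps P.l_distr P.minus_add P.a_ac)
  qed
  have smult: "act v (k \<odot>\<^bsub>V\<^esub> \<zeta>) = k \<odot>\<^bsub>V\<^esub> act v \<zeta>" if "k \<in> carrier K" "\<zeta> \<in> carrier V" for k \<zeta>
    using that
    by (cases v; cases \<zeta>)
      (auto simp: V_simps UP_smult_r_distr UP_smult_assoc2
        module.smult_r_minus[OF algebra.module[OF UP_algebra]])
  show ?thesis using closed add smult by (simp add: module_hom_def)
qed

lemma act_relation:
  assumes "\<zeta> \<in> carrier V"
  shows "act Letter_x (act Letter_x \<zeta>) \<oplus>\<^bsub>V\<^esub> a \<odot>\<^bsub>V\<^esub> act Letter_x \<zeta> \<oplus>\<^bsub>V\<^esub> b \<odot>\<^bsub>V\<^esub> \<zeta> = \<zero>\<^bsub>V\<^esub>"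
    and "act Letter_y (act Letter_y \<zeta>) \<oplus>\<^bsub>V\<^esub> c \<odot>\<^bsub>V\<^esub> act Letter_y \<zeta> \<oplus>\<^bsub>V\<^esub> d \<odot>\<^bsub>V\<^esub> \<zeta> = \<zero>\<^bsub>V\<^esub>"
proof -
  obtain p q r s where *: "\<zeta> = (p, q, r, s)"
    by (metis surj_pair)
  then have cl: "p \<in> carrier P" "q \<in> carrier P" "r \<in> carrier P" "s \<in> carrier P"
    using assms by (simp_all add: V_simps)
  have sm: "k \<odot>\<^bsub>P\<^esub> f = monom P k 0 \<otimes>\<^bsub>P\<^esub> f" if "k \<in> carrier K" "f \<in> carrier P" for k f
    using that by (simp add: monom_mult_is_smult)
  show "act Letter_x (act Letter_x \<zeta>) \<oplus>\<^bsub>V\<^esub> a \<odot>\<^bsub>V\<^esub> act Letter_x \<zeta> \<oplus>\<^bsub>V\<^esub> b \<odot>\<^bsub>V\<^esub> \<zeta> = \<zero>\<^bsub>V\<^esub>"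
    using cl by (simp add: * V_simps sm P.coordinates_relation_x)
  show "act Letter_y (act Letter_y \<zeta>) \<oplus>\<^bsub>V\<^esub> c \<odot>\<^bsub>V\<^esub> act Letter_y \<zeta> \<oplus>\<^bsub>V\<^esub> d \<odot>\<^bsub>V\<^esub> \<zeta> = \<zero>\<^bsub>V\<^esub>"
    using cl by (simp add: * V_simps sm P.coordinates_relation_y del: One_nat_def P.minus_minus)
qed

fun \<Phi> where "\<Phi> (p, q, r, s) = G.comb (\<phi> p) (\<phi> q) (\<phi> r) (\<phi> s)"

lemma act_closed: "\<zeta> \<in> carrier V \<Longrightarrow> act v \<zeta> \<in> carrier V"
  using act_hom[of v] by (auto simp: module_hom_def)

lemma \<Phi>_add:
  assumes "\<zeta> \<in> carrier V" "\<eta> \<in> carrier V"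
  shows "\<Phi> (\<zeta> \<oplus>\<^bsub>V\<^esub> \<eta>) = \<Phi> \<zeta> \<oplus>\<^bsub>F\<^esub> \<Phi> \<eta>"
  using assms by (cases \<zeta>; cases \<eta>)
    (simp add: V_simps G.comb_def \<phi>_simps F.A.l_distr F.M.a_ac)

lemma \<Phi>_smult:
  assumes "k \<in> carrier K" "\<zeta> \<in> carrier V"
  shows "\<Phi> (k \<odot>\<^bsub>V\<^esub> \<zeta>) = k \<odot>\<^bsub>F\<^esub> \<Phi> \<zeta>"
  using assms by (cases \<zeta>)
    (simp add: V_simps G.comb_def \<phi>_simps F.smult_r_distr F.smult_mult_left)

lemma \<Phi>_act:
  assumes "\<zeta> \<in> carrier V"
  shows "\<Phi> (act Letter_x \<zeta>) = x \<otimes>\<^bsub>F\<^esub> \<Phi> \<zeta>" "\<Phi> (act Letter_y \<zeta>) = y \<otimes>\<^bsub>F\<^esub> \<Phi> \<zeta>"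
  using assms
  by (cases \<zeta>; simp add: V_simps G.x_comb G.y_comb \<phi>_simps)+

text \<open>
  The combinations of \<open>1, x, y, x y\<close> with coefficients in \<open>K[\<tau>]\<close> are closed under left
  multiplication by the generators, by \<open>\<Phi>_act\<close>.
\<close>

lemma \<Phi>_surj:
  assumes "u \<in> carrier F"
  shows "\<exists>\<zeta>\<in>carrier V. u = \<Phi> \<zeta>"
proof -
  interpret V: module K V by (rule V_module)
  from assms show ?thesis
  proof (induction rule: G.generated_induct)
    case one
    have "\<one>\<^bsub>F\<^esub> = \<Phi> (\<one>\<^bsub>P\<^esub>, \<zero>\<^bsub>P\<^esub>, \<zero>\<^bsub>P\<^esub>, \<zero>\<^bsub>P\<^esub>)"
      by (simp add: G.comb_def \<phi>_simps)
    then show ?case by (rule bexI) (simp add: V_simps)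
  next
    case (add u v)
    then show ?case using \<Phi>_add V.a_closed by metis
  next
    case (smult k u)
    then show ?case using \<Phi>_smult V.smult_closed by metis
  next
    case (x u)
    then show ?case using \<Phi>_act(1) act_closed by metis
  next
    case (y u)
    then show ?case using \<Phi>_act(2) act_closed by metis
  qed
qed

fun poly_scale where "poly_scale f (p, q, r, s) = (f \<otimes>\<^bsub>P\<^esub> p, f \<otimes>\<^bsub>P\<^esub> q, f \<otimes>\<^bsub>P\<^esub> r, f \<otimes>\<^bsub>P\<^esub> s)"

text \<open>
  The operator that corresponds to \<open>\<tau>\<close> is multiplication by the indeterminate. For this reason
  the map \<open>\<Psi>\<close> obtained from the action is linear over polynomials in \<open>\<tau>\<close>.
\<close>

lemma act_trace:
  assumes "\<zeta> \<in> carrier V"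
  shows "act Letter_x (act Letter_y \<zeta>) \<oplus>\<^bsub>V\<^esub> act Letter_y (act Letter_x \<zeta>)
    \<oplus>\<^bsub>V\<^esub> c \<odot>\<^bsub>V\<^esub> act Letter_x \<zeta> \<oplus>\<^bsub>V\<^esub> a \<odot>\<^bsub>V\<^esub> act Letter_y \<zeta> = poly_scale pX \<zeta>"
proof -
  obtain p q r s where *: "\<zeta> = (p, q, r, s)"
    by (metis surj_pair)
  then have cl: "p \<in> carrier P" "q \<in> carrier P" "r \<in> carrier P" "s \<in> carrier P"
    using assms by (simp_all add: V_simps)
  have sm: "k \<odot>\<^bsub>P\<^esub> f = monom P k 0 \<otimes>\<^bsub>P\<^esub> f" if "k \<in> carrier K" "f \<in> carrier P" for k f
    using that by (simp add: monom_mult_is_smult)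
  show ?thesis
    using cl by (simp add: * V_simps sm P.coordinates_trace del: One_nat_def P.minus_minus)
qed

lemma \<Psi>_exists:
  "\<exists>\<Psi>\<in>module_hom K F V. \<Psi> \<one>\<^bsub>F\<^esub> = (\<one>\<^bsub>P\<^esub>, \<zero>\<^bsub>P\<^esub>, \<zero>\<^bsub>P\<^esub>, \<zero>\<^bsub>P\<^esub>) \<and>
    (\<forall>v. \<forall>u\<in>carrier F. \<Psi> (quad_gen K a b c d v \<otimes>\<^bsub>F\<^esub> u) = act v (\<Psi> u))"
  by (rule quad_alg_lift_module[OF V_module _ act_hom act_relation]) (simp_all add: V_simps)

text \<open>
  The map \<open>\<Psi>\<close> inverts \<open>\<Phi>\<close>: it is linear over \<open>K[\<tau>]\<close> and sends \<open>1, x, y, x y\<close> to the unit vectors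
  of \<open>K[X]\<^sup>4\<close>.
\<close>

lemma \<Phi>_inj:
  assumes "\<zeta> \<in> carrier V" "\<eta> \<in> carrier V" "\<Phi> \<zeta> = \<Phi> \<eta>"
  shows "\<zeta> = \<eta>"
proof -
  interpret V: module K V by (rule V_module)
  obtain \<Psi> where \<Psi>: "\<Psi> \<in> module_hom K F V" and one: "\<Psi> \<one>\<^bsub>F\<^esub> = (\<one>\<^bsub>P\<^esub>, \<zero>\<^bsub>P\<^esub>, \<zero>\<^bsub>P\<^esub>, \<zero>\<^bsub>P\<^esub>)"
    and gen: "\<And>v u. u \<in> carrier F \<Longrightarrow> \<Psi> (quad_gen K a b c d v \<otimes>\<^bsub>F\<^esub> u) = act v (\<Psi> u)"
    using \<Psi>_exists by blast
  interpret \<Psi>: mod_hom K F V \<Psi>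
    using \<Psi> V_module F.module_axioms by (simp add: mod_hom_def mod_hom_axioms_def)
  have \<tau>: "\<Psi> (G.\<tau> \<otimes>\<^bsub>F\<^esub> u) = poly_scale pX (\<Psi> u)" if u: "u \<in> carrier F" for u
  proof -
    have "G.\<tau> \<otimes>\<^bsub>F\<^esub> u = x \<otimes>\<^bsub>F\<^esub> (y \<otimes>\<^bsub>F\<^esub> u) \<oplus>\<^bsub>F\<^esub> y \<otimes>\<^bsub>F\<^esub> (x \<otimes>\<^bsub>F\<^esub> u)
        \<oplus>\<^bsub>F\<^esub> c \<odot>\<^bsub>F\<^esub> (x \<otimes>\<^bsub>F\<^esub> u) \<oplus>\<^bsub>F\<^esub> a \<odot>\<^bsub>F\<^esub> (y \<otimes>\<^bsub>F\<^esub> u)"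
      using u by (simp add: G.\<tau>_def F.A.l_distr F.A.m_assoc \<iota>_mult F.smult_mult_left)
    then show ?thesis using u by (simp add: gen act_trace)
  qed
  have scale: "\<Psi> (\<phi> p \<otimes>\<^bsub>F\<^esub> u) = poly_scale p (\<Psi> u)" if p: "p \<in> carrier P" and u: "u \<in> carrier F" for p u
    using p
  proof (induction rule: UP_induct)
    case (const k)
    then show ?case using u \<Psi>.f_im[OF u]
      by (cases "\<Psi> u") (simp add: \<phi>_const \<iota>_mult V_simps monom_mult_is_smult)
  next
    case (add p q)
    then show ?case using u \<Psi>.f_im[OF u]
      by (cases "\<Psi> u") (simp add: \<phi>_add F.A.l_distr V_simps P.l_distr)
  next
    case (X p)
    then show ?case using u \<Psi>.f_im[OF u]
      by (cases "\<Psi> u") (simp add: \<phi>_mult \<phi>_X \<phi>_X[unfolded One_nat_def] F.A.m_assoc \<tau> V_simps P.m_assoc)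
  qed
  have \<Psi>_x: "\<Psi> x = (\<zero>\<^bsub>P\<^esub>, \<one>\<^bsub>P\<^esub>, \<zero>\<^bsub>P\<^esub>, \<zero>\<^bsub>P\<^esub>)"
    using gen[of "\<one>\<^bsub>F\<^esub>" Letter_x] by (simp add: one)
  have \<Psi>_y: "\<Psi> y = (\<zero>\<^bsub>P\<^esub>, \<zero>\<^bsub>P\<^esub>, \<one>\<^bsub>P\<^esub>, \<zero>\<^bsub>P\<^esub>)"
    using gen[of "\<one>\<^bsub>F\<^esub>" Letter_y] by (simp add: one)
  have \<Psi>_xy: "\<Psi> (x \<otimes>\<^bsub>F\<^esub> y) = (\<zero>\<^bsub>P\<^esub>, \<zero>\<^bsub>P\<^esub>, \<zero>\<^bsub>P\<^esub>, \<one>\<^bsub>P\<^esub>)"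
    using gen[of y Letter_x] by (simp add: \<Psi>_y)
  have inv: "\<Psi> (\<Phi> \<xi>) = \<xi>" if "\<xi> \<in> carrier V" for \<xi>
  proof -
    obtain p q r s where *: "\<xi> = (p, q, r, s)"
      by (metis surj_pair)
    then have cl: "p \<in> carrier P" "q \<in> carrier P" "r \<in> carrier P" "s \<in> carrier P"
      using that by (simp_all add: V_simps)
    have "\<Psi> (\<phi> p) = (p, \<zero>\<^bsub>P\<^esub>, \<zero>\<^bsub>P\<^esub>, \<zero>\<^bsub>P\<^esub>)"
      using scale[of p "\<one>\<^bsub>F\<^esub>"] cl by (simp add: one)
    then show ?thesis
      using cl by (simp add: * G.comb_def scale \<Psi>_x \<Psi>_y \<Psi>_xy V_simps)
  qed
  show ?thesis using assms inv by metis
qed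

section \<open>Centre, basis and ideals\<close>

lemma \<Phi>_eq_zero:
  assumes "p \<in> carrier P" "q \<in> carrier P" "r \<in> carrier P" "s \<in> carrier P"
    "\<Phi> (p, q, r, s) = \<zero>\<^bsub>F\<^esub>"
  shows "p = \<zero>\<^bsub>P\<^esub>" "q = \<zero>\<^bsub>P\<^esub>" "r = \<zero>\<^bsub>P\<^esub>" "s = \<zero>\<^bsub>P\<^esub>"
proof -
  have "\<Phi> (\<zero>\<^bsub>P\<^esub>, \<zero>\<^bsub>P\<^esub>, \<zero>\<^bsub>P\<^esub>, \<zero>\<^bsub>P\<^esub>) = \<zero>\<^bsub>F\<^esub>"
    by (simp add: G.comb_def \<phi>_zero)
  then have "(p, q, r, s) = (\<zero>\<^bsub>P\<^esub>, \<zero>\<^bsub>P\<^esub>, \<zero>\<^bsub>P\<^esub>, \<zero>\<^bsub>P\<^esub>)"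
    using assms by (intro \<Phi>_inj) (simp_all add: V_simps)
  then show "p = \<zero>\<^bsub>P\<^esub>" "q = \<zero>\<^bsub>P\<^esub>" "r = \<zero>\<^bsub>P\<^esub>" "s = \<zero>\<^bsub>P\<^esub>" by simp_all
qed

lemma \<phi>_eq_zero_iff: "p \<in> carrier P \<Longrightarrow> \<phi> p = \<zero>\<^bsub>F\<^esub> \<longleftrightarrow> p = \<zero>\<^bsub>P\<^esub>"
  using \<Phi>_eq_zero(1)[of p "\<zero>\<^bsub>P\<^esub>" "\<zero>\<^bsub>P\<^esub>" "\<zero>\<^bsub>P\<^esub>"] by (auto simp: G.comb_def \<phi>_zero)

text \<open>
  The square of the commutator, as a polynomial.
\<close>

definition disc where
  "disc = pX \<otimes>\<^bsub>P\<^esub> pX \<oplus>\<^bsub>P\<^esub> pA \<otimes>\<^bsub>P\<^esub> (pC \<otimes>\<^bsub>P\<^esub> pX)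
    \<oplus>\<^bsub>P\<^esub> (pB \<otimes>\<^bsub>P\<^esub> (pC \<otimes>\<^bsub>P\<^esub> pC) \<oplus>\<^bsub>P\<^esub> pA \<otimes>\<^bsub>P\<^esub> (pA \<otimes>\<^bsub>P\<^esub> pD))
    \<oplus>\<^bsub>P\<^esub> \<ominus>\<^bsub>P\<^esub> (pB \<otimes>\<^bsub>P\<^esub> pD \<oplus>\<^bsub>P\<^esub> pB \<otimes>\<^bsub>P\<^esub> pD \<oplus>\<^bsub>P\<^esub> pB \<otimes>\<^bsub>P\<^esub> pD \<oplus>\<^bsub>P\<^esub> pB \<otimes>\<^bsub>P\<^esub> pD)"

lemma disc_closed [simp]: "disc \<in> carrier P"
  by (simp add: disc_def)

lemma w_squared: "G.w \<otimes>\<^bsub>F\<^esub> G.w = \<phi> disc"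
  by (simp add: G.w_squared G.squares_def disc_def \<phi>_simps)

text \<open>
  The polynomial is monic of degree two: the remaining terms have degree at most one.
\<close>

lemma disc_nonzero: "disc \<noteq> \<zero>\<^bsub>P\<^esub>"
proof -
  have const: "monom P k 0 \<otimes>\<^bsub>P\<^esub> monom P l n = monom P (k \<otimes> l) n"
    if "k \<in> carrier K" "l \<in> carrier K" for k l n
    using that monom_mult[of k l 0 n] by simp
  have "pX \<otimes>\<^bsub>P\<^esub> pX = monom P \<one> 2"
    using monom_mult[of \<one> \<one> 1 1] by (simp add: numeral_2_eq_2)
  then have "coeff P disc 2 = \<one>"
    by (simp add: disc_def const del: coeff_mult)
  then show ?thesis by auto
qed

lemma w_closed [simp]: "G.w \<in> carrier F"
  by (simp add: G.w_def)

lemma x_commutator_w: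
  assumes "p \<in> carrier P" "q \<in> carrier P" "r \<in> carrier P" "s \<in> carrier P"
  defines "u \<equiv> \<Phi> (p, q, r, s)"
  shows "(x \<otimes>\<^bsub>F\<^esub> u \<oplus>\<^bsub>F\<^esub> \<ominus>\<^bsub>F\<^esub> (u \<otimes>\<^bsub>F\<^esub> x)) \<otimes>\<^bsub>F\<^esub> G.w
    = \<Phi> (r \<otimes>\<^bsub>P\<^esub> disc, s \<otimes>\<^bsub>P\<^esub> disc, \<zero>\<^bsub>P\<^esub>, \<zero>\<^bsub>P\<^esub>)"
proof -
  have "(x \<otimes>\<^bsub>F\<^esub> u \<oplus>\<^bsub>F\<^esub> \<ominus>\<^bsub>F\<^esub> (u \<otimes>\<^bsub>F\<^esub> x)) \<otimes>\<^bsub>F\<^esub> G.w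
      = ((\<phi> r \<oplus>\<^bsub>F\<^esub> \<phi> s \<otimes>\<^bsub>F\<^esub> x) \<otimes>\<^bsub>F\<^esub> G.w) \<otimes>\<^bsub>F\<^esub> G.w"
    using assms by (simp add: G.x_commutator)
  also have "\<dots> = (\<phi> r \<oplus>\<^bsub>F\<^esub> \<phi> s \<otimes>\<^bsub>F\<^esub> x) \<otimes>\<^bsub>F\<^esub> \<phi> disc"
    using assms by (simp add: F.A.m_assoc w_squared)
  also have "\<dots> = \<Phi> (r \<otimes>\<^bsub>P\<^esub> disc, s \<otimes>\<^bsub>P\<^esub> disc, \<zero>\<^bsub>P\<^esub>, \<zero>\<^bsub>P\<^esub>)"
    using assms
    by (simp add: G.comb_def \<phi>_simps F.A.l_distr F.A.m_assoc G.central_to_left)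
  finally show ?thesis .
qed

lemma y_commutator_w:
  assumes "p \<in> carrier P" "q \<in> carrier P"
  defines "u \<equiv> \<Phi> (p, q, \<zero>\<^bsub>P\<^esub>, \<zero>\<^bsub>P\<^esub>)"
  shows "(u \<otimes>\<^bsub>F\<^esub> y \<oplus>\<^bsub>F\<^esub> \<ominus>\<^bsub>F\<^esub> (y \<otimes>\<^bsub>F\<^esub> u)) \<otimes>\<^bsub>F\<^esub> G.w = \<phi> (q \<otimes>\<^bsub>P\<^esub> disc)"
  using assms by (simp add: \<phi>_zero G.y_commutator F.A.m_assoc w_squared \<phi>_mult)

text \<open>
  All commutators of a central element vanish, and multiplication by the discriminant is
  injective on polynomials.
\<close>

lemma centre_eq: "carrier (centre F) = \<phi> ` carrier P"
proof (intro equalityI subsetI)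
  fix z assume z: "z \<in> carrier (centre F)"
  then obtain p q r s where *: "z = \<Phi> (p, q, r, s)"
    and cl: "p \<in> carrier P" "q \<in> carrier P" "r \<in> carrier P" "s \<in> carrier P"
    using \<Phi>_surj[OF centre_closed[OF z]] by (auto simp: V_simps simp del: \<Phi>.simps)
  have zF: "z \<in> carrier F" using z by (rule centre_closed)
  have "x \<otimes>\<^bsub>F\<^esub> z \<oplus>\<^bsub>F\<^esub> \<ominus>\<^bsub>F\<^esub> (z \<otimes>\<^bsub>F\<^esub> x) = \<zero>\<^bsub>F\<^esub>"
    using zF centre_commute[OF z, of x] by (simp add: F.M.r_neg)
  then have "\<Phi> (r \<otimes>\<^bsub>P\<^esub> disc, s \<otimes>\<^bsub>P\<^esub> disc, \<zero>\<^bsub>P\<^esub>, \<zero>\<^bsub>P\<^esub>) = \<zero>\<^bsub>F\<^esub>"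
    using x_commutator_w[OF cl] zF by (simp add: * del: \<Phi>.simps)
  then have "r \<otimes>\<^bsub>P\<^esub> disc = \<zero>\<^bsub>P\<^esub>" "s \<otimes>\<^bsub>P\<^esub> disc = \<zero>\<^bsub>P\<^esub>"
    using \<Phi>_eq_zero(1,2)[of "r \<otimes>\<^bsub>P\<^esub> disc" "s \<otimes>\<^bsub>P\<^esub> disc" "\<zero>\<^bsub>P\<^esub>" "\<zero>\<^bsub>P\<^esub>"] cl
    by (simp_all del: \<Phi>.simps)
  then have rs: "r = \<zero>\<^bsub>P\<^esub>" "s = \<zero>\<^bsub>P\<^esub>"
    using cl disc_nonzero UP_integral disc_closed by blast+
  have "z \<otimes>\<^bsub>F\<^esub> y \<oplus>\<^bsub>F\<^esub> \<ominus>\<^bsub>F\<^esub> (y \<otimes>\<^bsub>F\<^esub> z) = \<zero>\<^bsub>F\<^esub>"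
    using zF centre_commute[OF z, of y] by (simp add: F.M.r_neg)
  then have "\<phi> (q \<otimes>\<^bsub>P\<^esub> disc) = \<zero>\<^bsub>F\<^esub>"
    using y_commutator_w[OF cl(1,2)] by (simp add: * rs del: \<Phi>.simps)
  then have "q \<otimes>\<^bsub>P\<^esub> disc = \<zero>\<^bsub>P\<^esub>"
    using cl by (simp add: \<phi>_eq_zero_iff)
  then have "q = \<zero>\<^bsub>P\<^esub>"
    using cl disc_nonzero UP_integral disc_closed by blast
  then have "z = \<phi> p" using cl by (simp add: * rs G.comb_def \<phi>_zero)
  then show "z \<in> \<phi> ` carrier P" using cl by blast
qed auto

lemma \<phi>_inj: "inj_on \<phi> (carrier P)"
proof (rule inj_onI)
  fix p q assume "p \<in> carrier P" "q \<in> carrier P" "\<phi> p = \<phi> q"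
  then have "(p, \<zero>\<^bsub>P\<^esub>, \<zero>\<^bsub>P\<^esub>, \<zero>\<^bsub>P\<^esub>) = (q, \<zero>\<^bsub>P\<^esub>, \<zero>\<^bsub>P\<^esub>, \<zero>\<^bsub>P\<^esub>)"
    by (intro \<Phi>_inj) (simp_all add: V_simps)
  then show "p = q" by simp
qed

lemma centre_iso: "inv_into (carrier P) \<phi> \<in> alg_iso K (centre F) P"
proof -
  have bij: "bij_betw \<phi> (carrier P) (carrier (centre F))"
    using \<phi>_inj centre_eq by (simp add: bij_betw_def)
  have "\<phi> \<in> ring_iso P (centre F)"
    using \<phi>_hom bij by (simp add: ring_iso_def)
  then have "inv_into (carrier P) \<phi> \<in> ring_iso (centre F) P"
    by (rule ring_iso_set_sym[OF P.ring_axioms])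
  moreover have "inv_into (carrier P) \<phi> (k \<odot>\<^bsub>centre F\<^esub> z) = k \<odot>\<^bsub>P\<^esub> inv_into (carrier P) \<phi> z"
    if k: "k \<in> carrier K" and z: "z \<in> carrier (centre F)" for k z
  proof -
    obtain p where p: "p \<in> carrier P" "z = \<phi> p" using z centre_eq by blast
    then show ?thesis
      using k \<phi>_inj by (simp add: inv_into_f_f flip: \<phi>_smult)
  qed
  ultimately show ?thesis by (simp add: alg_iso_def)
qed

abbreviation "B \<equiv> {\<one>\<^bsub>F\<^esub>, x, y, x \<otimes>\<^bsub>F\<^esub> y}"

lemma B_distinct:
  "\<one>\<^bsub>F\<^esub> \<noteq> x" "\<one>\<^bsub>F\<^esub> \<noteq> y" "\<one>\<^bsub>F\<^esub> \<noteq> x \<otimes>\<^bsub>F\<^esub> y" "x \<noteq> y" "x \<noteq> x \<otimes>\<^bsub>F\<^esub> y" "y \<noteq> x \<otimes>\<^bsub>F\<^esub> y"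
proof -
  let ?z = "\<zero>\<^bsub>P\<^esub>" and ?o = "\<one>\<^bsub>P\<^esub>"
  have eqs: "\<one>\<^bsub>F\<^esub> = \<Phi> (?o, ?z, ?z, ?z)" "x = \<Phi> (?z, ?o, ?z, ?z)" "y = \<Phi> (?z, ?z, ?o, ?z)"
    "x \<otimes>\<^bsub>F\<^esub> y = \<Phi> (?z, ?z, ?z, ?o)"
    by (simp_all add: G.comb_def \<phi>_zero \<phi>_one)
  have inj: "\<zeta> \<noteq> \<eta> \<Longrightarrow> \<Phi> \<zeta> \<noteq> \<Phi> \<eta>" if "\<zeta> \<in> carrier V" "\<eta> \<in> carrier V" for \<zeta> \<eta>
    using \<Phi>_inj that by blast
  show "\<one>\<^bsub>F\<^esub> \<noteq> x" "\<one>\<^bsub>F\<^esub> \<noteq> y" "\<one>\<^bsub>F\<^esub> \<noteq> x \<otimes>\<^bsub>F\<^esub> y" "x \<noteq> y" "x \<noteq> x \<otimes>\<^bsub>F\<^esub> y" "y \<noteq> x \<otimes>\<^bsub>F\<^esub> y"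
    unfolding eqs(4) unfolding eqs(1-3) by (rule inj; simp add: V_simps UP_one_not_zero UP_one_not_zero[symmetric])+
qed

lemma card_B: "card B = 4"
  using B_distinct by simp

text \<open>
  A coefficient in the centre is a polynomial in \<open>\<tau>\<close> by \<open>centre_eq\<close>, so spanning and
  independence are \<open>\<Phi>_surj\<close> and \<open>\<Phi>_eq_zero\<close>.
\<close>

lemma free_B: "free_with_basis (centre F) (mult_module F) B"
proof -
  interpret m: module "centre F" "mult_module F" by (rule F.centre_mult_module)
  have B: "B \<subseteq> carrier (mult_module F)" by simp
  have lincomb: "m.lincomb h B = G.comb (h \<one>\<^bsub>F\<^esub>) (h x) (h y) (h (x \<otimes>\<^bsub>F\<^esub> y))"
    if "h \<in> B \<rightarrow> carrier (centre F)" for h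
  proof -
    have h: "h \<one>\<^bsub>F\<^esub> \<in> carrier F" "h x \<in> carrier F" "h y \<in> carrier F" "h (x \<otimes>\<^bsub>F\<^esub> y) \<in> carrier F"
      using that by (auto intro: centre_closed)
    then show ?thesis
      using B_distinct by (simp add: m.lincomb_def G.comb_def F.M.a_assoc)
  qed
  have "m.span B = carrier (mult_module F)"
  proof
    show "m.span B \<subseteq> carrier (mult_module F)" using B by (rule m.span_is_subset2)
    show "carrier (mult_module F) \<subseteq> m.span B"
    proof
      fix u assume "u \<in> carrier (mult_module F)"
      then obtain p q r s where u: "u = \<Phi> (p, q, r, s)"
        and cl: "p \<in> carrier P" "q \<in> carrier P" "r \<in> carrier P" "s \<in> carrier P"
        using \<Phi>_surj[of u] by (auto simp: V_simps simp del: \<Phi>.simps)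
      define h where "h v = (if v = \<one>\<^bsub>F\<^esub> then \<phi> p else if v = x then \<phi> q else if v = y then \<phi> r else \<phi> s)" for v
      have h: "h \<in> B \<rightarrow> carrier (centre F)" using cl by (simp add: h_def)
      have "u = m.lincomb h B"
        using B_distinct by (subst lincomb[OF h]) (simp add: u h_def)
      then show "u \<in> m.span B"
        using h B by (subst m.finite_span) auto
    qed
  qed
  moreover have "\<not> m.lin_dep B"
  proof (rule m.finite_lin_indpt2[OF _ B])
    fix h assume h: "h \<in> B \<rightarrow> carrier (centre F)" and zero: "m.lincomb h B = \<zero>\<^bsub>mult_module F\<^esub>"
    obtain p q r s where hs: "h \<one>\<^bsub>F\<^esub> = \<phi> p" "h x = \<phi> q" "h y = \<phi> r" "h (x \<otimes>\<^bsub>F\<^esub> y) = \<phi> s"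
      and cl: "p \<in> carrier P" "q \<in> carrier P" "r \<in> carrier P" "s \<in> carrier P"
      using h unfolding centre_eq by fastforce
    have "\<Phi> (p, q, r, s) = \<zero>\<^bsub>F\<^esub>"
      using zero lincomb[OF h] hs by simp
    from \<Phi>_eq_zero[OF cl this] show "\<forall>v\<in>B. h v = \<zero>\<^bsub>centre F\<^esub>"
      using hs by (simp add: \<phi>_zero)
  qed simp
  ultimately show ?thesis
    unfolding free_with_basis_def using m.module_axioms B by simp
qed

text \<open>
  At most two commutators lead from any nonzero element to a nonzero central one: the commutator
  with \<open>x\<close> removes \<open>y\<close> and \<open>x y\<close>, the commutator with \<open>y\<close> then removes \<open>x\<close>. A step is only taken
  if it does not give zero.
\<close>

lemma ideal_meets_centre:
  assumes I: "ideal I F" and nonzero: "I \<noteq> {\<zero>\<^bsub>F\<^esub>}"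
  shows "\<exists>f\<in>carrier P. f \<noteq> \<zero>\<^bsub>P\<^esub> \<and> \<phi> f \<in> I"
proof -
  interpret I: ideal I F by (rule I)
  have commutator: "(g \<otimes>\<^bsub>F\<^esub> u \<oplus>\<^bsub>F\<^esub> \<ominus>\<^bsub>F\<^esub> (u \<otimes>\<^bsub>F\<^esub> g)) \<otimes>\<^bsub>F\<^esub> G.w \<in> I"
    "(u \<otimes>\<^bsub>F\<^esub> g \<oplus>\<^bsub>F\<^esub> \<ominus>\<^bsub>F\<^esub> (g \<otimes>\<^bsub>F\<^esub> u)) \<otimes>\<^bsub>F\<^esub> G.w \<in> I"
    if "u \<in> I" "g \<in> carrier F" for u g
    using that by (simp_all add: I.I_l_closed I.I_r_closed I.a_closed I.a_inv_closed)
  have two: "\<exists>f\<in>carrier P. f \<noteq> \<zero>\<^bsub>P\<^esub> \<and> \<phi> f \<in> I"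
    if pq: "p \<in> carrier P" "q \<in> carrier P" "p \<noteq> \<zero>\<^bsub>P\<^esub> \<or> q \<noteq> \<zero>\<^bsub>P\<^esub>"
      and mem: "\<Phi> (p, q, \<zero>\<^bsub>P\<^esub>, \<zero>\<^bsub>P\<^esub>) \<in> I" for p q
  proof (cases "q = \<zero>\<^bsub>P\<^esub>")
    case True
    then show ?thesis using pq mem by (auto simp: G.comb_def \<phi>_zero)
  next
    case False
    have "\<phi> (q \<otimes>\<^bsub>P\<^esub> disc) \<in> I"
      using commutator(2)[OF mem G.xy(2)] y_commutator_w[OF pq(1,2)] by (simp del: \<Phi>.simps)
    moreover have "q \<otimes>\<^bsub>P\<^esub> disc \<noteq> \<zero>\<^bsub>P\<^esub>"
      using False disc_nonzero pq UP_integral[of q disc] by auto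
    ultimately show ?thesis
      using pq(2) by (intro bexI[of _ "q \<otimes>\<^bsub>P\<^esub> disc"] conjI UP_mult_closed disc_closed)
  qed
  obtain u where u: "u \<in> I" "u \<noteq> \<zero>\<^bsub>F\<^esub>"
    using nonzero I.zero_closed by blast
  obtain p q r s where *: "u = \<Phi> (p, q, r, s)"
    and cl: "p \<in> carrier P" "q \<in> carrier P" "r \<in> carrier P" "s \<in> carrier P"
    using \<Phi>_surj[OF I.Icarr[OF u(1)]] by (auto simp: V_simps simp del: \<Phi>.simps)
  show ?thesis
  proof (cases "r = \<zero>\<^bsub>P\<^esub> \<and> s = \<zero>\<^bsub>P\<^esub>")
    case True
    moreover from this have "p \<noteq> \<zero>\<^bsub>P\<^esub> \<or> q \<noteq> \<zero>\<^bsub>P\<^esub>"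
      using u by (auto simp: * G.comb_def \<phi>_zero)
    ultimately show ?thesis using two[OF cl(1,2)] u by (simp add: * del: \<Phi>.simps)
  next
    case False
    then have "r \<otimes>\<^bsub>P\<^esub> disc \<noteq> \<zero>\<^bsub>P\<^esub> \<or> s \<otimes>\<^bsub>P\<^esub> disc \<noteq> \<zero>\<^bsub>P\<^esub>"
      using disc_nonzero cl UP_integral[of r disc] UP_integral[of s disc] by auto
    moreover have "\<Phi> (r \<otimes>\<^bsub>P\<^esub> disc, s \<otimes>\<^bsub>P\<^esub> disc, \<zero>\<^bsub>P\<^esub>, \<zero>\<^bsub>P\<^esub>) \<in> I"
      using commutator(1)[OF u(1) G.xy(1)] x_commutator_w[OF cl] by (simp add: * del: \<Phi>.simps)
    ultimately show ?thesis
      using two cl by (meson UP_mult_closed disc_closed)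
  qed
qed

text \<open>
  An ideal that contains \<open>f(\<tau>)\<close> contains \<open>f(\<tau>) F\<close>, so coefficients may be reduced modulo \<open>f\<close>.
  Pseudodivision multiplies the dividend by a power of the leading coefficient of \<open>f\<close>, which is
  a unit because \<open>K\<close> is a field.
\<close>

theorem nonzero_ideal_finite_codim:
  assumes I: "ideal I F" and nonzero: "I \<noteq> {\<zero>\<^bsub>F\<^esub>}"
  shows "finite_codim K F I"
proof -
  interpret I: ideal I F by (rule I)
  interpret Q: unital_algebra K "quot_alg F I" by (rule F.quot_alg_unital_algebra[OF I])
  interpret Q: vectorspace K "quot_alg F I" by unfold_locales
  define \<pi> where "\<pi> u = I +>\<^bsub>F\<^esub> u" for u
  have \<pi>_closed: "\<pi> u \<in> carrier (quot_alg F I)" if "u \<in> carrier F" for u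
    using that by (simp add: \<pi>_def quot_alg_simps)
  have \<pi>_add: "\<pi> (u \<oplus>\<^bsub>F\<^esub> v) = \<pi> u \<oplus>\<^bsub>quot_alg F I\<^esub> \<pi> v" if "u \<in> carrier F" "v \<in> carrier F" for u v
    using that by (simp add: \<pi>_def F.quot_alg_coset[OF I])
  have \<pi>_smult: "\<pi> (k \<odot>\<^bsub>F\<^esub> u) = k \<odot>\<^bsub>quot_alg F I\<^esub> \<pi> u" if "k \<in> carrier K" "u \<in> carrier F" for k u
    using that by (simp add: \<pi>_def F.quot_alg_smult[OF I])
  have \<pi>_I: "\<pi> u = \<zero>\<^bsub>quot_alg F I\<^esub>" if "u \<in> I" for u
    using that I.Icarr by (simp add: \<pi>_def F.quot_alg_eq_zero_iff[OF I])

  obtain f where f: "f \<in> carrier P" "f \<noteq> \<zero>\<^bsub>P\<^esub>" "\<phi> f \<in> I"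
    using ideal_meets_centre[OF I nonzero] by blast
  define E where "E = (\<lambda>(i, e). \<pi> (\<phi> (monom P \<one> i) \<otimes>\<^bsub>F\<^esub> e)) ` ({..<deg K f} \<times> B)"
  have B_closed: "e \<in> carrier F" if "e \<in> B" for e using that by auto
  have E_closed: "E \<subseteq> carrier (quot_alg F I)"
  proof
    fix C assume "C \<in> E"
    then obtain z where z: "z \<in> {..<deg K f} \<times> B"
      "C = (\<lambda>(i, e). \<pi> (\<phi> (monom P \<one> i) \<otimes>\<^bsub>F\<^esub> e)) z"
      unfolding E_def by blast
    then have "C = \<pi> (\<phi> (monom P \<one> (fst z)) \<otimes>\<^bsub>F\<^esub> snd z)" "snd z \<in> carrier F"
      using B_closed[of "snd z"] by (simp_all only: split_beta mem_Times_iff)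
    then show "C \<in> carrier (quot_alg F I)" by (simp add: \<pi>_closed)
  qed
  have E_finite: "finite E" by (simp add: E_def)
  interpret S: submodule K "Q.span E" "quot_alg F I"
    using Q.span_is_submodule[OF E_closed] .

  have small: "\<pi> (\<phi> r \<otimes>\<^bsub>F\<^esub> e) \<in> Q.span E"
    if r: "r \<in> carrier P" "r = \<zero>\<^bsub>P\<^esub> \<or> deg K r < deg K f" and e: "e \<in> B" for r e
  proof -
    have "\<pi> (\<phi> (\<Oplus>\<^bsub>P\<^esub>i\<in>J. monom P (coeff P r i) i) \<otimes>\<^bsub>F\<^esub> e) \<in> Q.span E"
      if "finite J" "J \<subseteq> {..<deg K f}" for J
      using that
    proof (induction J)
      case empty
      then show ?case using B_closed[OF e] by (simp add: \<phi>_zero \<pi>_I I.zero_closed)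
    next
      case (insert i J)
      have "\<pi> (\<phi> (monom P \<one> i) \<otimes>\<^bsub>F\<^esub> e) \<in> E"
        using insert.prems e by (auto simp: E_def)
      then have i: "\<pi> (\<phi> (monom P \<one> i) \<otimes>\<^bsub>F\<^esub> e) \<in> Q.span E"
        using Q.in_own_span[OF E_closed] by blast
      have "monom P (coeff P r i) i = coeff P r i \<odot>\<^bsub>P\<^esub> monom P \<one> i"
        using monom_mult_smult[of "coeff P r i" \<one> i] r by simp
      then have "\<pi> (\<phi> (monom P (coeff P r i) i) \<otimes>\<^bsub>F\<^esub> e)
          = coeff P r i \<odot>\<^bsub>quot_alg F I\<^esub> \<pi> (\<phi> (monom P \<one> i) \<otimes>\<^bsub>F\<^esub> e)"
        using r B_closed[OF e] by (simp add: \<phi>_smult F.smult_mult_left \<pi>_smult)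
      then have "\<pi> (\<phi> (monom P (coeff P r i) i) \<otimes>\<^bsub>F\<^esub> e) \<in> Q.span E"
        using i r by simp
      then show ?case
        using insert r B_closed[OF e]
        by (simp add: Pi_def \<phi>_add F.A.l_distr \<pi>_add)
    qed
    note sums = this
    show ?thesis
    proof (cases "r = \<zero>\<^bsub>P\<^esub>")
      case True
      then show ?thesis using sums[of "{}"] by simp
    next
      case False
      then have "{..deg K r} \<subseteq> {..<deg K f}" using r(2) by auto
      then show ?thesis using sums[of "{..deg K r}"] up_repr[OF r(1)] by simp
    qed
  qed

  have big: "\<pi> (\<phi> g \<otimes>\<^bsub>F\<^esub> e) \<in> Q.span E" if g: "g \<in> carrier P" and e: "e \<in> B" for g e
  proof -
    note eF = B_closed[OF e]
    obtain q r and k :: nat where div: "q \<in> carrier P" "r \<in> carrier P"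
      "lcoeff f [^] k \<odot>\<^bsub>P\<^esub> g = f \<otimes>\<^bsub>P\<^esub> q \<oplus>\<^bsub>P\<^esub> r" "r = \<zero>\<^bsub>P\<^esub> \<or> deg K r < deg K f"
      using long_div_theorem[OF f(1) g f(2)] by blast
    define l where "l = lcoeff f [^] k"
    have "lcoeff f \<in> Units K"
      using lcoeff_nonzero[OF f(2,1)] f(1) by (simp add: field_Units)
    then have "l \<in> Units K" unfolding l_def by (induction k) simp_all
    then have l: "l \<in> carrier K" "inv l \<in> carrier K" "inv l \<otimes> l = \<one>"
      by (simp_all add: K.Units_closed)
    have "\<phi> (f \<otimes>\<^bsub>P\<^esub> q) \<otimes>\<^bsub>F\<^esub> e \<in> I"
      using f div eF by (simp add: \<phi>_mult I.I_r_closed)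
    moreover have "l \<odot>\<^bsub>F\<^esub> (\<phi> g \<otimes>\<^bsub>F\<^esub> e) = \<phi> (f \<otimes>\<^bsub>P\<^esub> q) \<otimes>\<^bsub>F\<^esub> e \<oplus>\<^bsub>F\<^esub> \<phi> r \<otimes>\<^bsub>F\<^esub> e"
    proof -
      have "l \<odot>\<^bsub>F\<^esub> (\<phi> g \<otimes>\<^bsub>F\<^esub> e) = \<phi> (l \<odot>\<^bsub>P\<^esub> g) \<otimes>\<^bsub>F\<^esub> e"
        using l g eF by (simp add: \<phi>_smult F.smult_mult_left)
      then show ?thesis
        unfolding div(3)[folded l_def] using f div eF by (simp add: \<phi>_add F.A.l_distr)
    qed
    ultimately have "l \<odot>\<^bsub>quot_alg F I\<^esub> \<pi> (\<phi> g \<otimes>\<^bsub>F\<^esub> e) = \<pi> (\<phi> r \<otimes>\<^bsub>F\<^esub> e)"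
      using l g f div eF
      by (simp flip: \<pi>_smult) (simp add: \<pi>_add \<pi>_I \<pi>_closed)
    then have "\<pi> (\<phi> g \<otimes>\<^bsub>F\<^esub> e) = inv l \<odot>\<^bsub>quot_alg F I\<^esub> \<pi> (\<phi> r \<otimes>\<^bsub>F\<^esub> e)"
      using l g eF Q.smult_assoc1[of "inv l" l "\<pi> (\<phi> g \<otimes>\<^bsub>F\<^esub> e)"] by (simp add: \<pi>_closed)
    then show ?thesis using small[OF div(2,4) e] l by simp
  qed

  have "carrier (quot_alg F I) \<subseteq> Q.span E"
  proof
    fix C assume "C \<in> carrier (quot_alg F I)"
    then obtain u where u: "u \<in> carrier F" "C = \<pi> u"
      by (auto simp: quot_alg_simps \<pi>_def)
    then obtain p q r s where *: "u = \<Phi> (p, q, r, s)"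
      and cl: "p \<in> carrier P" "q \<in> carrier P" "r \<in> carrier P" "s \<in> carrier P"
      using \<Phi>_surj[of u] by (auto simp: V_simps simp del: \<Phi>.simps)
    show "C \<in> Q.span E"
      using big[OF cl(1), of "\<one>\<^bsub>F\<^esub>"] big[OF cl(2), of x] big[OF cl(3), of y] big[OF cl(4), of "x \<otimes>\<^bsub>F\<^esub> y"] cl
      by (simp add: u * G.comb_def \<pi>_add)
  qed
  then have "Q.span E = carrier (quot_alg F I)"
    using Q.span_is_subset2[OF E_closed] by blast
  then show ?thesis
    unfolding finite_codim_def Q.fin_dim_def
    using E_finite E_closed Q.vectorspace_axioms by blast
qed

end

theorem theorem4:
  fixes K :: "('k, 'm) ring_scheme" and a b c d :: 'k
  assumes "field K"
    and "a \<in> carrier K" "b \<in> carrier K" "c \<in> carrier K" "d \<in> carrier K"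
  shows
    "let F = quad_alg K a b c d;
         x = quad_gen K a b c d Letter_x;
         y = quad_gen K a b c d Letter_y;
         B = {\<one>\<^bsub>F\<^esub>, x, y, x \<otimes>\<^bsub>F\<^esub> y}
     in ((\<exists>h. h \<in> alg_iso K (centre F) (UP K)) \<and>
         free_with_basis (centre F) (mult_module F) B \<and> card B = 4) \<and>
        (\<forall>I. ideal I F \<and> I \<noteq> {\<zero>\<^bsub>F\<^esub>} \<longrightarrow> finite_codim K F I)"
proof -
  interpret K: field K by fact
  interpret two_quadratics_field K "UP K" a b c d
    by unfold_locales (use assms in auto)
  show ?thesis
    unfolding Let_def using centre_iso free_B card_B nonzero_ideal_finite_codim by blast
qed

end
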